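(* Let $G=\mathrm{SL}(2,\mathbb{R})$ and consider the torus $A<G$ of diagonal matrices with positive entries, with Lie algebra $\mathfrak{a}\cong\mathbb{R}$. The inclusion $$i:H^1_m(A)\longrightarrow H^2_m\big(G\curvearrowright\mathbb{P}^1(\mathbb{R})^2\big)$$ of the short exact sequence $$0\longrightarrow H^1_m(A)\overset{i}{\longrightarrow}H^2_m(G\curvearrowright G/A)\longrightarrow H^2_m(G)\longrightarrow 0$$ (see the context) is given by sending an $\mathbb{R}$-linear form $\alpha_{\mathfrak{a}}\in\mathfrak{a}^*$ to the measurable, almost everywhere defined, $G$-invariant cocycle $$i(\alpha_{\mathfrak{a}}):(\mathbb{P}^1(\mathbb{R})^2)^3\longrightarrow\mathbb{R},\qquad \big((x_1,x_2),(y_1,y_2),(z_1,z_2)\big)\longmapsto\frac{1}{2}\,\alpha_{\mathfrak{a}}\big(\log\big|[x_2,y_1,y_2,z_1]-1\big|\big),$$ where $[\,\cdot\,,\,\cdot\,,\,\cdot\,,\,\cdot\,]$ is the usual cross ratio.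
   Context: $L^0(X)$ denotes the space of real-valued measurable functions on $X$ modulo equality almost everywhere. For a locally compact group $H$, $H^*_m(H)$ is the measurable cohomology, i.e. the cohomology of $(L^0(H^{*+1})^H,d^* )$ with $d^*$ the homogeneous coboundary operator. For a closed subgroup $L<G$, $H^*_m(G\curvearrowright G/L)$ is the cohomology of $(L^0((G/L)^{*+1})^G,d^* )$, where $G/L$ carries its invariant measure class. The evaluation map $H^*_m(G\curvearrowright G/L)\to H^*_m(G)$ is induced by $f\mapsto\big((g_0,\dots,g_p)\mapsto f(g_0x,\dots,g_px)\big)$ for a fixed basepoint $x\in G/L$. $G$ acts diagonally on $\mathbb{P}^1(\mathbb{R})^2=(\mathbb{R}\cup\{\infty\})^2$ by fractional linear transformations. The quotient $G/A$ is identified with the full measure subset of $\mathbb{P}^1(\mathbb{R})^2$ consisting of distinct ordered pairs, with basepoint $(\infty,0)$, so that $H^2_m(G\curvearrowright G/A)$ is written $H^2_m(G\curvearrowright\mathbb{P}^1(\mathbb{R})^2)$. One has $H^1_m(A)\cong\mathfrak{a}^*\cong\mathbb{R}$, where $\alpha_{\mathfrak{a}}\in\mathfrak{a}^*$ corresponds to the class of the homomorphism $\overline{\alpha}(a)=\alpha_{\mathfrak{a}}(\log a)$, with homogeneous cocycle $(a_0,a_1)\mapsto\overline{\alpha}(a_1)-\overline{\alpha}(a_0)$. The cross ratio is normalized by $[\infty,0,1,b]=b$. In the short exact sequence the second map is the evaluation map, and $i$ is the isomorphism onto its kernel obtained from the following bicomplex. Let $C^{p,q}=L^0(G^{p+1}\times(G/A)^q)^G$,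 let $d^\uparrow:C^{p,q}\to C^{p+1,q}$ be the homogeneous differential in the $G$-variables and $d^\rightarrow:C^{p,q}\to C^{p,q+1}$ the homogeneous differential in the $G/A$-variables multiplied by $(-1)^{p+1}$. Eckmann–Shapiro induction identifies $L^0(G^{p+1})^A$ with $C^{p,1}$ by $\overline{f}(g_0,\dots,g_p)(hA)=f(h^{-1}g_0,\dots,h^{-1}g_p)$, and $H^p_m(A)$ is the cohomology of $(L^0(G^{*+1})^A,d^* )\cong(C^{*,1},d^\uparrow)$. Given a class in $H^1_m(A)$ represented by $a\in C^{1,1}$ with $d^\uparrow a=0$, one takes $\beta\in C^{0,2}$ with $d^\uparrow\beta=d^\rightarrow a$; then $\omega=d^\rightarrow\beta\in C^{0,3}$ satisfies $d^\uparrow\omega=0$, so it does not depend on the $G$-variable and defines a cocycle in $L^0((G/A)^3)^G$, which represents the image of the given class under $i$.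
   Formalization: The unspecified identification of the Lie algebra with the reals is taken as t ↔ diag(-2t, 2t), the only one making the factor 1/2 correct; under t ↔ diag(t, -t) the proved cocycle is -α(log|[x_2,y_1,y_2,z_1]-1|), not (1/2)α(log|...|). *)

theory Defs
  imports "HOL-Analysis.Analysis"
begin

section \<open>Spaces of measurable functions and measurable cohomology\<close>

text \<open>
  An element of \<open>L\<^sup>0\<close> is handled through its representatives: real-valued measurable functions,
  with every equation between them required almost everywhere. An \<open>n\<close>-tuple of points of \<open>M\<close> is a
  point of the product measure space indexed by \<open>{..<n}\<close>.
\<close>

abbreviation tuples :: "nat \<Rightarrow> 'x measure \<Rightarrow> (nat \<Rightarrow> 'x) measure" where
  "tuples n M \<equiv> PiM {..<n} (\<lambda>_. M)"

definition diag_act :: "nat \<Rightarrow> ('g \<Rightarrow> 'x \<Rightarrow> 'x) \<Rightarrow> 'g \<Rightarrow> (nat \<Rightarrow> 'x) \<Rightarrow> (nat \<Rightarrow> 'x)" where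
  "diag_act n act g x = (\<lambda>i\<in>{..<n}. act g (x i))"

text \<open>
  Invariance is that of the class in \<open>L\<^sup>0\<close>: the exceptional null set may depend on \<open>g\<close>.
\<close>

definition L0_inv :: "'g set \<Rightarrow> ('g \<Rightarrow> 'x \<Rightarrow> 'x) \<Rightarrow> 'x measure \<Rightarrow> ('x \<Rightarrow> real) set" where
  "L0_inv \<Gamma> act M = {f \<in> borel_measurable M. \<forall>g\<in>\<Gamma>. AE x in M. f (act g x) = f x}"

definition cochains ::
  "'g set \<Rightarrow> ('g \<Rightarrow> 'x \<Rightarrow> 'x) \<Rightarrow> 'x measure \<Rightarrow> nat \<Rightarrow> ((nat \<Rightarrow> 'x) \<Rightarrow> real) set" where
  "cochains \<Gamma> act M p = L0_inv \<Gamma> (diag_act (Suc p) act) (tuples (Suc p) M)"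

text \<open>\<open>face n i\<close> omits the entry \<open>i\<close> from an \<open>(n+1)\<close>-tuple; \<open>hdiff n\<close> is the homogeneous
  differential from functions of \<open>n\<close> variables to functions of \<open>n + 1\<close> variables.\<close>

definition face :: "nat \<Rightarrow> nat \<Rightarrow> (nat \<Rightarrow> 'x) \<Rightarrow> (nat \<Rightarrow> 'x)" where
  "face n i x = (\<lambda>j\<in>{..<n}. x (if j < i then j else Suc j))"

definition hdiff :: "nat \<Rightarrow> ((nat \<Rightarrow> 'x) \<Rightarrow> real) \<Rightarrow> (nat \<Rightarrow> 'x) \<Rightarrow> real" where
  "hdiff n f x = (\<Sum>i\<le>n. (-1) ^ i * f (face n i x))"

definition cocycles ::
  "'g set \<Rightarrow> ('g \<Rightarrow> 'x \<Rightarrow> 'x) \<Rightarrow> 'x measure \<Rightarrow> nat \<Rightarrow> ((nat \<Rightarrow> 'x) \<Rightarrow> real) set" where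
  "cocycles \<Gamma> act M p =
     {f \<in> cochains \<Gamma> act M p. AE x in tuples (Suc (Suc p)) M. hdiff (Suc p) f x = 0}"

definition coboundaries ::
  "'g set \<Rightarrow> ('g \<Rightarrow> 'x \<Rightarrow> 'x) \<Rightarrow> 'x measure \<Rightarrow> nat \<Rightarrow> ((nat \<Rightarrow> 'x) \<Rightarrow> real) set" where
  "coboundaries \<Gamma> act M p =
     {f \<in> cochains \<Gamma> act M p.
        case p of
          0 \<Rightarrow> AE x in tuples (Suc p) M. f x = 0
        | Suc q \<Rightarrow> \<exists>h\<in>cochains \<Gamma> act M q. AE x in tuples (Suc p) M. f x = hdiff p h x}"

text \<open>
  A cohomology class is the set of all measurable functions representing it, so that equality of
  classes is equality of sets.
\<close>

definition cohomologous ::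
  "'g set \<Rightarrow> ('g \<Rightarrow> 'x \<Rightarrow> 'x) \<Rightarrow> 'x measure \<Rightarrow> nat
    \<Rightarrow> (((nat \<Rightarrow> 'x) \<Rightarrow> real) \<times> ((nat \<Rightarrow> 'x) \<Rightarrow> real)) set" where
  "cohomologous \<Gamma> act M p =
     {(f, f'). f \<in> cocycles \<Gamma> act M p \<and> f' \<in> cocycles \<Gamma> act M p \<and>
               (\<lambda>x. f' x - f x) \<in> coboundaries \<Gamma> act M p}"

definition cohomology ::
  "'g set \<Rightarrow> ('g \<Rightarrow> 'x \<Rightarrow> 'x) \<Rightarrow> 'x measure \<Rightarrow> nat \<Rightarrow> ((nat \<Rightarrow> 'x) \<Rightarrow> real) set set" where
  "cohomology \<Gamma> act M p = cocycles \<Gamma> act M p // cohomologous \<Gamma> act M p"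

definition cohom_class ::
  "'g set \<Rightarrow> ('g \<Rightarrow> 'x \<Rightarrow> 'x) \<Rightarrow> 'x measure \<Rightarrow> nat
    \<Rightarrow> ((nat \<Rightarrow> 'x) \<Rightarrow> real) \<Rightarrow> ((nat \<Rightarrow> 'x) \<Rightarrow> real) set" where
  "cohom_class \<Gamma> act M p f = cohomologous \<Gamma> act M p `` {f}"


section \<open>The group, the torus and their Haar measures\<close>

definition SL2 :: "(real^2^2) set" where
  "SL2 = {g. det g = 1}"

text \<open>
  The Haar measure of a Borel set \<open>B\<close> of \<open>SL2\<close> is the Lebesgue measure (in the four-dimensional
  space of matrices) of the cone of all \<open>t *\<^sub>R g\<close> with \<open>0 < t \<le> 1\<close> and \<open>g \<in> B\<close>. It is invariant
  because multiplication by \<open>g \<in> SL2\<close> has determinant \<open>1\<close> on the space of matrices.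
\<close>

definition haar_SL2 :: "(real^2^2) measure" where
  "haar_SL2 = distr (restrict_space lborel {m. 0 < det m \<and> det m \<le> 1})
                    (restrict_space borel SL2)
                    (\<lambda>m. m /\<^sub>R sqrt (det m))"

definition diag2 :: "real \<Rightarrow> real \<Rightarrow> real^2^2" where
  "diag2 s t = vector [vector [s, 0], vector [0, t]]"

definition torus :: "(real^2^2) set" where
  "torus = {diag2 t (1 / t) | t. 0 < t}"

definition haar_torus :: "(real^2^2) measure" where
  "haar_torus = distr lborel (restrict_space borel torus) (\<lambda>t. diag2 (exp t) (exp (- t)))"


section \<open>The Lie algebra of the torus and its dual\<close>

definition lie_torus :: "(real^2^2) set" where
  "lie_torus = {diag2 t (- t) | t. True}"

definition lie_torus_dual :: "(real^2^2 \<Rightarrow> real) set" where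
  "lie_torus_dual =
     {\<alpha>. (\<forall>x\<in>lie_torus. \<forall>y\<in>lie_torus. \<alpha> (x + y) = \<alpha> x + \<alpha> y) \<and>
         (\<forall>c. \<forall>x\<in>lie_torus. \<alpha> (c *\<^sub>R x) = c * \<alpha> x)}"

text \<open>The inverse of the exponential map from \<open>lie_torus\<close> to \<open>torus\<close>.\<close>

definition log_torus :: "real^2^2 \<Rightarrow> real^2^2" where
  "log_torus a = diag2 (ln (a $ 1 $ 1)) (ln (a $ 2 $ 2))"

definition alpha_bar :: "(real^2^2 \<Rightarrow> real) \<Rightarrow> real^2^2 \<Rightarrow> real" where
  "alpha_bar \<alpha> a = \<alpha> (log_torus a)"

definition torus_cocycle :: "(real^2^2 \<Rightarrow> real) \<Rightarrow> (nat \<Rightarrow> real^2^2) \<Rightarrow> real" where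
  "torus_cocycle \<alpha> a = alpha_bar \<alpha> (a 1) - alpha_bar \<alpha> (a 0)"

text \<open>
  The linear identification of \<open>\<real>\<close> with the Lie algebra that is used to evaluate a linear form on a
  real number. Its normalisation is not a free choice: given the sign conventions used below for
  the differentials, the base point of \<open>G/A\<close> and the cross ratio, it is the only one for which
  \<open>1/2 * \<alpha> (ln \<bar>[x\<^sub>2, y\<^sub>1, y\<^sub>2, z\<^sub>1] - 1\<bar>)\<close> represents the image of the class of \<open>alpha_bar \<alpha>\<close>. In the
  coordinate \<open>t\<close> of \<open>diag2 t (- t)\<close> the same cocycle reads \<open>- \<alpha> (ln \<bar>[x\<^sub>2, y\<^sub>1, y\<^sub>2, z\<^sub>1] - 1\<bar>)\<close>.
\<close>

definition lie_of_real :: "real \<Rightarrow> real^2^2" where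
  "lie_of_real t = diag2 (- 2 * t) (2 * t)"


section \<open>The projective line and the cross ratio\<close>

datatype P1 = Infty | Pt real

text \<open>The Borel structure and the class of Lebesgue measure on the affine part; the point at
  infinity is a null set.\<close>

definition P1_measure :: "P1 measure" where
  "P1_measure = distr lborel (sigma UNIV {S. Pt -` S \<in> sets borel}) Pt"

fun mobius :: "real^2^2 \<Rightarrow> P1 \<Rightarrow> P1" where
  "mobius g Infty = (if g$2$1 = 0 then Infty else Pt (g$1$1 / g$2$1))"
| "mobius g (Pt t) =
     (if g$2$1 * t + g$2$2 = 0 then Infty
      else Pt ((g$1$1 * t + g$1$2) / (g$2$1 * t + g$2$2)))"

fun hcoord :: "P1 \<Rightarrow> real \<times> real" where
  "hcoord Infty = (1, 0)"
| "hcoord (Pt t) = (t, 1)"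

definition bracket :: "P1 \<Rightarrow> P1 \<Rightarrow> real" where
  "bracket x y = fst (hcoord x) * snd (hcoord y) - snd (hcoord x) * fst (hcoord y)"

text \<open>In affine coordinates \<open>(a - c) (d - b) / ((a - d) (c - b))\<close>; only meaningful where the
  denominator does not vanish.\<close>

definition cross_ratio :: "P1 \<Rightarrow> P1 \<Rightarrow> P1 \<Rightarrow> P1 \<Rightarrow> real" where
  "cross_ratio a b c d = (bracket a c * bracket d b) / (bracket a d * bracket c b)"

lemma cross_ratio_normalised: "cross_ratio Infty (Pt 0) (Pt 1) (Pt b) = b"
  by (simp add: cross_ratio_def bracket_def)


section \<open>The quotient \<open>G/A\<close> as a space of pairs\<close>

text \<open>The coset \<open>hA\<close> is identified with the pair \<open>(h \<infinity>, h 0)\<close>; the pairs which do not arise form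
  the diagonal, a null set.\<close>

definition pairs :: "(P1 \<times> P1) measure" where
  "pairs = P1_measure \<Otimes>\<^sub>M P1_measure"

definition mobius_pair :: "real^2^2 \<Rightarrow> P1 \<times> P1 \<Rightarrow> P1 \<times> P1" where
  "mobius_pair g x = (mobius g (fst x), mobius g (snd x))"

definition coset_pair :: "real^2^2 \<Rightarrow> P1 \<times> P1" where
  "coset_pair h = mobius_pair h (Infty, Pt 0)"


section \<open>The bicomplex and the map \<open>i\<close>\<close>

text \<open>In \<open>bicomplex p q\<close> there are \<open>p + 1\<close> variables in \<open>G\<close> and \<open>q\<close> variables in \<open>G/A\<close>.\<close>

definition bispace :: "nat \<Rightarrow> nat \<Rightarrow> ((nat \<Rightarrow> real^2^2) \<times> (nat \<Rightarrow> P1 \<times> P1)) measure" where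
  "bispace p q = tuples (Suc p) haar_SL2 \<Otimes>\<^sub>M tuples q pairs"

definition biact ::
  "nat \<Rightarrow> nat \<Rightarrow> real^2^2 \<Rightarrow> (nat \<Rightarrow> real^2^2) \<times> (nat \<Rightarrow> P1 \<times> P1)
    \<Rightarrow> (nat \<Rightarrow> real^2^2) \<times> (nat \<Rightarrow> P1 \<times> P1)" where
  "biact p q g z = (diag_act (Suc p) (**) g (fst z), diag_act q mobius_pair g (snd z))"

definition bicomplex :: "nat \<Rightarrow> nat \<Rightarrow> ((nat \<Rightarrow> real^2^2) \<times> (nat \<Rightarrow> P1 \<times> P1) \<Rightarrow> real) set" where
  "bicomplex p q = L0_inv SL2 (biact p q) (bispace p q)"

definition d_up ::
  "nat \<Rightarrow> ((nat \<Rightarrow> real^2^2) \<times> (nat \<Rightarrow> P1 \<times> P1) \<Rightarrow> real)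
    \<Rightarrow> (nat \<Rightarrow> real^2^2) \<times> (nat \<Rightarrow> P1 \<times> P1) \<Rightarrow> real" where
  "d_up p f z = hdiff (Suc p) (\<lambda>g. f (g, snd z)) (fst z)"

definition d_right ::
  "nat \<Rightarrow> nat \<Rightarrow> ((nat \<Rightarrow> real^2^2) \<times> (nat \<Rightarrow> P1 \<times> P1) \<Rightarrow> real)
    \<Rightarrow> (nat \<Rightarrow> real^2^2) \<times> (nat \<Rightarrow> P1 \<times> P1) \<Rightarrow> real" where
  "d_right p q f z = (-1) ^ (p + 1) * hdiff q (\<lambda>y. f (fst z, y)) (snd z)"

text \<open>
  Eckmann--Shapiro induction \<open>F (g\<^sub>0, \<dots>, g\<^sub>p) (hA) = f (h\<^sup>-\<^sup>1 g\<^sub>0, \<dots>, h\<^sup>-\<^sup>1 g\<^sub>p)\<close>, as a relation between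
  an \<open>A\<close>-invariant \<open>f\<close> on \<open>G\<^sup>p\<^sup>+\<^sup>1\<close> and \<open>F \<in> bicomplex p 1\<close>. A function on \<open>G/A\<close> defined almost
  everywhere is the same as a right \<open>A\<close>-invariant one on \<open>G\<close>, so \<open>h\<close> ranges over almost all of \<open>G\<close>.
\<close>

definition eckmann_shapiro ::
  "nat \<Rightarrow> ((nat \<Rightarrow> real^2^2) \<Rightarrow> real) \<Rightarrow> ((nat \<Rightarrow> real^2^2) \<times> (nat \<Rightarrow> P1 \<times> P1) \<Rightarrow> real) \<Rightarrow> bool"
where
  "eckmann_shapiro p f F \<longleftrightarrow>
     f \<in> cochains torus (**) haar_SL2 p \<and> F \<in> bicomplex p 1 \<and>
     (AE z in haar_SL2 \<Otimes>\<^sub>M tuples (Suc p) haar_SL2.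
        F (snd z, \<lambda>j\<in>{..<1}. coset_pair (fst z)) =
        f (diag_act (Suc p) (**) (matrix_inv (fst z)) (snd z)))"

text \<open>
  The canonical isomorphism between the cohomologies of \<open>L\<^sup>0(A\<^sup>*\<^sup>+\<^sup>1)\<^sup>A\<close> and \<open>L\<^sup>0(G\<^sup>*\<^sup>+\<^sup>1)\<^sup>A\<close> is
  pull-back along an \<open>A\<close>-equivariant measurable map \<open>G \<rightarrow> A\<close> for which preimages of null sets are
  null; on cohomology it does not depend on the map, so that any such map is allowed.
\<close>

definition equivariant_to_torus :: "(real^2^2 \<Rightarrow> real^2^2) \<Rightarrow> bool" where
  "equivariant_to_torus r \<longleftrightarrow>
     r \<in> measurable haar_SL2 haar_torus \<and>
     absolutely_continuous haar_torus (distr haar_SL2 haar_torus r) \<and>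
     (\<forall>a\<in>torus. \<forall>g\<in>SL2. r (a ** g) = a ** r g)"

text \<open>\<open>a \<in> bicomplex 1 1\<close> represents the class of \<open>f\<close> under the identification of
  \<open>H\<^sup>1\<^sub>m(A)\<close> with the first cohomology of the column \<open>(bicomplex * 1, d_up)\<close>.\<close>

definition represents ::
  "((nat \<Rightarrow> real^2^2) \<times> (nat \<Rightarrow> P1 \<times> P1) \<Rightarrow> real) \<Rightarrow> ((nat \<Rightarrow> real^2^2) \<Rightarrow> real) \<Rightarrow> bool" where
  "represents a f \<longleftrightarrow>
     f \<in> cocycles torus (**) haar_torus 1 \<and>
     a \<in> bicomplex 1 1 \<and> (AE z in bispace 2 1. d_up 1 a z = 0) \<and>
     (\<exists>r F b. equivariant_to_torus r \<and>
        eckmann_shapiro 1 (\<lambda>g. f (\<lambda>i\<in>{..<2}. r (g i))) F \<and>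
        b \<in> bicomplex 0 1 \<and> (AE z in bispace 1 1. a z = F z + d_up 0 b z))"

definition connecting ::
  "((nat \<Rightarrow> real^2^2) \<Rightarrow> real) set \<Rightarrow> ((nat \<Rightarrow> P1 \<times> P1) \<Rightarrow> real) set \<Rightarrow> bool" where
  "connecting c D \<longleftrightarrow>
     c \<in> cohomology torus (**) haar_torus 1 \<and>
     (\<exists>f a \<beta> \<omega>.
        f \<in> c \<and> represents a f \<and>
        \<beta> \<in> bicomplex 0 2 \<and> (AE z in bispace 1 2. d_up 0 \<beta> z = d_right 1 1 a z) \<and>
        \<omega> \<in> cocycles SL2 mobius_pair pairs 2 \<and>
        (AE z in bispace 0 3. d_right 0 2 \<beta> z = \<omega> (snd z)) \<and>
        D = cohom_class SL2 mobius_pair pairs 2 \<omega>)"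

text \<open>The description is by uniqueness: an equation \<open>i_map c = D\<close> can only be established by
  showing that \<open>D\<close> is reached from \<open>c\<close> and that all choices lead to \<open>D\<close>.\<close>

definition i_map ::
  "((nat \<Rightarrow> real^2^2) \<Rightarrow> real) set \<Rightarrow> ((nat \<Rightarrow> P1 \<times> P1) \<Rightarrow> real) set" where
  "i_map c = (THE D. connecting c D)"

end

theory Submission
  imports Defs
begin

text \<open>
  Let \<open>N p g\<close> be the norm of the row vector \<open>(v, -u) g\<close>, where \<open>(u, v)\<close> are the homogeneous
  coordinates of \<open>p\<close>. Retracting \<open>G\<close> to the torus by the norm of the first row of a matrix turns the
  torus cocycle into \<open>c (ln N(x\<^sub>2, g\<^sub>1) - ln N(x\<^sub>2, g\<^sub>0))\<close> on \<open>G\<^sup>2 \<times> G/A\<close>. A primitive of its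
  horizontal differential is \<open>c (ln N(y\<^sub>2, g) - ln N(x\<^sub>2, g))\<close>, corrected by the \<open>G\<close>-independent term
  \<open>c (ln |x\<^sub>2 - y\<^sub>1| - ln |y\<^sub>1 - y\<^sub>2|)\<close> which makes it invariant; the horizontal differential of this
  primitive is \<open>- c ln |[x\<^sub>2, y\<^sub>1, y\<^sub>2, z\<^sub>1] - 1|\<close>.

  Any other choice differs from this one, in \<open>C\<^sup>0\<^sup>,\<^sup>2\<close>, by a horizontal differential plus a function
  that is killed by \<open>d_up\<close>, hence does not depend on the \<open>G\<close>-variable and bounds the difference of
  the two resulting cocycles. All null set arguments rest on maps for which preimages of null sets
  are null, and on Fubini applied to translations.
\<close>

section \<open>Nonsingular maps\<close>

text \<open>The coordinates of kx are k times those of x up to a factor l(x). Hence N(kx, kg) =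
  |l(x)| N(x, g), while the bracket of x and y, a 2 by 2 determinant, acquires l(x) l(y). This
  dictates the correction term: N(y_2, g) / N(x_2, g) acquires |l(y_2) / l(x_2)|, the quotient of
  the brackets of (x_2, y_1) and (y_1, y_2) acquires the inverse, and the factor of the auxiliary
  point y_1 cancels. The Pluecker relation recombines the brackets into the cross ratio minus 1. The
  sign is the (-1)^(p+1) of \<open>d_right\<close> at p = 0; the constant c is
  \<open>slope \<alpha>\<close>.

  The obstacle to uniqueness is the centre of G: the stabiliser of (infinity, 0) consists of all
  diagonal matrices, twice the torus, whereas a retraction allowed in \<open>represents\<close> is
  equivariant only under the torus. The function comparing two retractions need not descend to pairs
  until it is averaged over the centre.

  Elements of L^0 see only measure classes, so no density is ever computed: pulling back null sets
  is the one property required of a map.\<close>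

definition nonsingular :: "'a measure \<Rightarrow> 'b measure \<Rightarrow> ('a \<Rightarrow> 'b) \<Rightarrow> bool" where
  "nonsingular M N f \<longleftrightarrow> f \<in> measurable M N \<and> (\<forall>A\<in>null_sets N. f -` A \<inter> space M \<in> null_sets M)"

lemma nonsingular_measurable: "nonsingular M N f \<Longrightarrow> f \<in> measurable M N"
  by (simp add: nonsingular_def)

lemma nonsingular_AE:
  assumes "nonsingular M N f" "AE y in N. P y"
  shows "AE x in M. P (f x)"
proof -
  obtain A where A: "A \<in> null_sets N" "{y\<in>space N. \<not> P y} \<subseteq> A"
    using assms(2) unfolding eventually_ae_filter by auto
  have "f -` A \<inter> space M \<in> null_sets M"
    using assms(1) A(1) by (simp add: nonsingular_def)
  moreover have "{x\<in>space M. \<not> P (f x)} \<subseteq> f -` A \<inter> space M"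
    using A(2) measurable_space[OF nonsingular_measurable[OF assms(1)]] by auto
  ultimately show ?thesis
    unfolding eventually_ae_filter by blast
qed

lemma nonsingularI:
  assumes "f \<in> measurable M N" "\<And>A. A \<in> null_sets N \<Longrightarrow> AE x in M. f x \<notin> A"
  shows "nonsingular M N f"
  unfolding nonsingular_def
proof (intro conjI ballI)
  fix A assume A: "A \<in> null_sets N"
  have S: "f -` A \<inter> space M \<in> sets M"
    using A assms(1) by (auto intro: measurable_sets)
  have "AE x in M. x \<notin> f -` A \<inter> space M"
    using assms(2)[OF A] by auto
  then show "f -` A \<inter> space M \<in> null_sets M"
    using AE_iff_null_sets[OF S] by simp
qed fact

lemma nonsingular_not_in: "nonsingular M N f \<Longrightarrow> A \<in> null_sets N \<Longrightarrow> AE x in M. f x \<notin> A"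
  by (rule nonsingular_AE[OF _ AE_not_in])

lemma nonsingular_ident: "nonsingular M M (\<lambda>x. x)"
  by (rule nonsingularI) (auto dest: AE_not_in)

lemma nonsingular_compose:
  assumes "nonsingular L M f" "nonsingular M N g"
  shows "nonsingular L N (\<lambda>x. g (f x))"
proof (rule nonsingularI)
  show "(\<lambda>x. g (f x)) \<in> measurable L N"
    using assms by (auto intro: measurable_compose dest: nonsingular_measurable)
  show "AE x in L. g (f x) \<notin> A" if "A \<in> null_sets N" for A
    by (rule nonsingular_AE[OF assms(1) nonsingular_not_in[OF assms(2) that]])
qed

lemma nonsingular_cong:
  assumes "nonsingular M N f" "\<And>x. x \<in> space M \<Longrightarrow> f x = g x"
  shows "nonsingular M N g"
proof (rule nonsingularI)
  show "g \<in> measurable M N"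
    using nonsingular_measurable[OF assms(1)] assms(2) measurable_cong[of M f g N] by blast
  show "AE x in M. g x \<notin> A" if "A \<in> null_sets N" for A
    using nonsingular_not_in[OF assms(1) that] assms(2) by (auto elim!: AE_mp intro!: AE_I2)
qed

lemma nonsingular_of_distr:
  assumes "f \<in> measurable M N" "distr M N f = N"
  shows "nonsingular M N f"
proof (rule nonsingularI)
  fix A assume "A \<in> null_sets N"
  then have "AE y in distr M N f. y \<notin> A"
    unfolding assms(2) by (rule AE_not_in)
  then show "AE x in M. f x \<notin> A"
    by (rule AE_distrD[OF assms(1)])
qed fact

section \<open>Products of two measures and Fubini\<close>

lemma pair_sigma_finiteI:
  "sigma_finite_measure M \<Longrightarrow> sigma_finite_measure N \<Longrightarrow> pair_sigma_finite M N"
  by (simp add: pair_sigma_finite_def)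

lemma sigma_finite_pair:
  assumes "sigma_finite_measure M" "sigma_finite_measure N"
  shows "sigma_finite_measure (M \<Otimes>\<^sub>M N)"
proof -
  interpret pair_sigma_finite M N by (rule pair_sigma_finiteI) fact+
  show ?thesis by unfold_locales
qed

lemma AE_pairD:
  assumes "sigma_finite_measure M" "sigma_finite_measure N" "AE z in M \<Otimes>\<^sub>M N. P z"
  shows "AE x in M. AE y in N. P (x, y)"
  using pair_sigma_finite.AE_pair[OF pair_sigma_finiteI[OF assms(1,2)] assms(3)] .

lemma AE_pairI:
  assumes "sigma_finite_measure M" "sigma_finite_measure N"
    "{z\<in>space (M \<Otimes>\<^sub>M N). P z} \<in> sets (M \<Otimes>\<^sub>M N)" "AE x in M. AE y in N. P (x, y)"
  shows "AE z in M \<Otimes>\<^sub>M N. P z"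
  using pair_sigma_finite.AE_pair_measure[OF pair_sigma_finiteI[OF assms(1,2)] assms(3,4)] .

lemma AE_notin_pairI:
  assumes "sigma_finite_measure M" "sigma_finite_measure N" "A \<in> sets L"
    "f \<in> measurable (M \<Otimes>\<^sub>M N) L" "AE x in M. AE y in N. f (x, y) \<notin> A"
  shows "AE z in M \<Otimes>\<^sub>M N. f z \<notin> A"
proof (rule AE_pairI[OF assms(1,2) _ assms(5)])
  have "f -` A \<inter> space (M \<Otimes>\<^sub>M N) \<in> sets (M \<Otimes>\<^sub>M N)"
    by (rule measurable_sets[OF assms(4,3)])
  moreover have "{z \<in> space (M \<Otimes>\<^sub>M N). f z \<notin> A} =
      space (M \<Otimes>\<^sub>M N) - (f -` A \<inter> space (M \<Otimes>\<^sub>M N))"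
    by auto
  ultimately show "{z \<in> space (M \<Otimes>\<^sub>M N). f z \<notin> A} \<in> sets (M \<Otimes>\<^sub>M N)"
    by auto
qed

text \<open>Fubini: the exceptional set is null because each of its sections at a fixed first
  coordinate is null. The map may mix the two coordinates, as in the passage from (h, g) to the
  translate of g by the inverse of h.\<close>

lemma nonsingular_sections:
  assumes "sigma_finite_measure M1" "sigma_finite_measure M2"
    and "f \<in> measurable (M1 \<Otimes>\<^sub>M M2) N"
    and "\<And>x. x \<in> space M1 \<Longrightarrow> nonsingular M2 N (\<lambda>y. f (x, y))"
  shows "nonsingular (M1 \<Otimes>\<^sub>M M2) N f"
proof (rule nonsingularI[OF assms(3)])
  fix A assume A: "A \<in> null_sets N"
  have "AE x in M1. AE y in M2. f (x, y) \<notin> A"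
    by (rule AE_I2) (rule nonsingular_not_in[OF assms(4) A])
  then show "AE z in M1 \<Otimes>\<^sub>M M2. f z \<notin> A"
    using A by (intro AE_notin_pairI[OF assms(1,2) _ assms(3)]) auto
qed

lemma nonsingular_map_pair:
  assumes "sigma_finite_measure M1" "sigma_finite_measure M2"
    "sigma_finite_measure N1" "sigma_finite_measure N2"
    and f: "nonsingular M1 N1 f" and g: "nonsingular M2 N2 g"
  shows "nonsingular (M1 \<Otimes>\<^sub>M M2) (N1 \<Otimes>\<^sub>M N2) (\<lambda>z. (f (fst z), g (snd z)))"
proof (rule nonsingularI)
  note [measurable] = nonsingular_measurable[OF f] nonsingular_measurable[OF g]
  show m: "(\<lambda>z. (f (fst z), g (snd z))) \<in> measurable (M1 \<Otimes>\<^sub>M M2) (N1 \<Otimes>\<^sub>M N2)"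
    by measurable
  fix A assume A: "A \<in> null_sets (N1 \<Otimes>\<^sub>M N2)"
  have "AE x in N1. AE y in N2. (x, y) \<notin> A"
    by (rule AE_pairD[OF assms(3,4) AE_not_in[OF A]])
  then have "AE x in M1. AE y in N2. (f x, y) \<notin> A"
    by (rule nonsingular_AE[OF f])
  then have "AE x in M1. AE y in M2. (f x, g y) \<notin> A"
    by (rule AE_mp) (auto intro!: AE_I2 nonsingular_AE[OF g])
  then show "AE z in M1 \<Otimes>\<^sub>M M2. (f (fst z), g (snd z)) \<notin> A"
    using A by (intro AE_notin_pairI[OF assms(1,2) _ m]) auto
qed

lemma nonsingular_fst:
  assumes "sigma_finite_measure M" "sigma_finite_measure N"
  shows "nonsingular (M \<Otimes>\<^sub>M N) M fst"
proof (rule nonsingularI)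
  fix A assume A: "A \<in> null_sets M"
  show "AE z in M \<Otimes>\<^sub>M N. fst z \<notin> A"
    using A AE_not_in[OF A] by (intro AE_notin_pairI[OF assms _ measurable_fst]) auto
qed simp

lemma nonsingular_snd:
  assumes "sigma_finite_measure M" "sigma_finite_measure N"
  shows "nonsingular (M \<Otimes>\<^sub>M N) N snd"
  by (rule nonsingular_sections[OF assms]) (auto intro: nonsingular_ident)

lemma nonsingular_swap:
  assumes "sigma_finite_measure M" "sigma_finite_measure N"
  shows "nonsingular (M \<Otimes>\<^sub>M N) (N \<Otimes>\<^sub>M M) (\<lambda>z. (snd z, fst z))"
proof (rule nonsingular_of_distr[THEN nonsingular_cong])
  interpret pair_sigma_finite N M by (rule pair_sigma_finiteI) fact+
  show "(\<lambda>(x, y). (y, x)) \<in> measurable (M \<Otimes>\<^sub>M N) (N \<Otimes>\<^sub>M M)"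
    by measurable
  show "distr (M \<Otimes>\<^sub>M N) (N \<Otimes>\<^sub>M M) (\<lambda>(x, y). (y, x)) = N \<Otimes>\<^sub>M M"
    by (rule distr_pair_swap[symmetric])
qed auto

section \<open>Finite powers of a sigma-finite measure\<close>

lemma sigma_finite_PiM:
  assumes "sigma_finite_measure M" "finite I"
  shows "sigma_finite_measure (PiM I (\<lambda>_. M))"
proof -
  interpret product_sigma_finite "\<lambda>_. M" by (simp add: product_sigma_finite_def assms(1))
  show ?thesis by (rule sigma_finite) fact
qed

lemma nonsingular_merge:
  assumes "sigma_finite_measure M" "finite I" "finite J" "I \<inter> J = {}"
  shows "nonsingular (PiM I (\<lambda>_. M) \<Otimes>\<^sub>M PiM J (\<lambda>_. M)) (PiM (I \<union> J) (\<lambda>_. M)) (merge I J)"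
proof -
  interpret product_sigma_finite "\<lambda>_. M" by (simp add: product_sigma_finite_def assms(1))
  show ?thesis
    by (rule nonsingular_of_distr[OF measurable_merge distr_merge]) fact+
qed

text \<open>By \<open>distr_merge\<close> the product over the union is the image of the pair
  product under \<open>merge\<close>, and restricting to \<open>I\<close> and \<open>J\<close>
  undoes merging. The claim thus reduces to the identity map of the pair product.\<close>

lemma nonsingular_unmerge:
  assumes "sigma_finite_measure M" "finite I" "finite J" "I \<inter> J = {}"
  shows "nonsingular (PiM (I \<union> J) (\<lambda>_. M)) (PiM I (\<lambda>_. M) \<Otimes>\<^sub>M PiM J (\<lambda>_. M))
           (\<lambda>x. (restrict x I, restrict x J))"
proof -
  interpret product_sigma_finite "\<lambda>_. M" by (simp add: product_sigma_finite_def assms(1))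
  let ?P = "PiM I (\<lambda>_. M) \<Otimes>\<^sub>M PiM J (\<lambda>_. M)"
  have m: "(\<lambda>x. (restrict x I, restrict x J)) \<in> measurable (PiM (I \<union> J) (\<lambda>_. M)) ?P"
    by (intro measurable_Pair measurable_restrict_subset) auto
  show ?thesis
  proof (rule nonsingularI[OF m])
    fix A assume A: "A \<in> null_sets ?P"
    let ?B = "{x\<in>space (PiM (I \<union> J) (\<lambda>_. M)). (restrict x I, restrict x J) \<notin> A}"
    have B: "?B \<in> sets (PiM (I \<union> J) (\<lambda>_. M))"
    proof -
      have "?B = space (PiM (I \<union> J) (\<lambda>_. M)) -
          ((\<lambda>x. (restrict x I, restrict x J)) -` A \<inter> space (PiM (I \<union> J) (\<lambda>_. M)))"
        by auto
      then show ?thesis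
        using measurable_sets[OF m, of A] A by auto
    qed
    have "AE z in ?P. (restrict (merge I J z) I, restrict (merge I J z) J) \<notin> A"
      using AE_not_in[OF A]
    proof (rule AE_mp, intro AE_I2 impI)
      fix z assume "z \<in> space ?P" "z \<notin> A"
      then show "(restrict (merge I J z) I, restrict (merge I J z) J) \<notin> A"
        using assms(4) by (cases z) (auto simp: space_pair_measure space_PiM PiE_restrict)
    qed
    then have "AE x in distr ?P (PiM (I \<union> J) (\<lambda>_. M)) (merge I J). (restrict x I, restrict x J) \<notin> A"
      by (subst AE_distr_iff[OF measurable_merge B])
    then show "AE x in PiM (I \<union> J) (\<lambda>_. M). (restrict x I, restrict x J) \<notin> A"
      by (subst (asm) distr_merge[OF assms(4,2,3)])
  qed
qed

lemma nonsingular_restrict: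
  assumes "sigma_finite_measure M" "finite K" "I \<subseteq> K"
  shows "nonsingular (PiM K (\<lambda>_. M)) (PiM I (\<lambda>_. M)) (\<lambda>x. restrict x I)"
proof -
  have K: "I \<union> (K - I) = K" using assms(3) by blast
  have fin: "finite I" "finite (K - I)" using assms(2,3) by (auto intro: finite_subset)
  show ?thesis
    using nonsingular_compose[OF nonsingular_unmerge[OF assms(1) fin]
        nonsingular_fst[OF sigma_finite_PiM sigma_finite_PiM], OF _ assms(1) fin(1) assms(1) fin(2)]
    unfolding K by simp
qed

text \<open>Measure preserving, since a product measure is determined by its values on boxes and the
  preimage of a box is the box with its factors relabelled along the inverse of
  \<open>\<sigma>\<close>.\<close>

lemma nonsingular_bij_reindex:
  assumes "sigma_finite_measure M" "finite J" "inj_on \<sigma> J"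
  shows "nonsingular (PiM (\<sigma> ` J) (\<lambda>_. M)) (PiM J (\<lambda>_. M)) (\<lambda>x. \<lambda>j\<in>J. x (\<sigma> j))"
proof -
  interpret product_sigma_finite "\<lambda>_. M" by (simp add: product_sigma_finite_def assms(1))
  let ?P = "PiM (\<sigma> ` J) (\<lambda>_. M)" and ?h = "\<lambda>x. \<lambda>j\<in>J. x (\<sigma> j)"
  have m: "?h \<in> measurable ?P (PiM J (\<lambda>_. M))"
    by (intro measurable_restrict measurable_component_singleton) auto
  show ?thesis
  proof (rule nonsingular_of_distr[OF m], rule PiM_eqI)
    fix A assume A: "\<And>j. j \<in> J \<Longrightarrow> A j \<in> sets M"
    let ?A' = "\<lambda>i. A (the_inv_into J \<sigma> i)"
    have A': "A (the_inv_into J \<sigma> (\<sigma> j)) = A j" if "j \<in> J" for j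
      using that assms(3) by (simp add: the_inv_into_f_f)
    have "?h -` Pi\<^sub>E J A \<inter> space ?P = Pi\<^sub>E (\<sigma> ` J) ?A'"
    proof (intro set_eqI iffI)
      fix x assume "x \<in> ?h -` Pi\<^sub>E J A \<inter> space ?P"
      then have "x \<in> extensional (\<sigma> ` J)" "\<forall>j\<in>J. x (\<sigma> j) \<in> A j"
        by (auto simp: space_PiM PiE_iff restrict_def)
      then show "x \<in> Pi\<^sub>E (\<sigma> ` J) ?A'"
        by (simp add: PiE_iff A')
    next
      fix x assume "x \<in> Pi\<^sub>E (\<sigma> ` J) ?A'"
      then have x: "x \<in> extensional (\<sigma> ` J)" "\<forall>j\<in>J. x (\<sigma> j) \<in> A j"
        by (simp_all add: PiE_iff A')
      then have "\<forall>j\<in>J. x (\<sigma> j) \<in> space M"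
        using sets.sets_into_space[OF A] by blast
      then show "x \<in> ?h -` Pi\<^sub>E J A \<inter> space ?P"
        using x by (simp add: space_PiM PiE_iff restrict_def extensional_def)
    qed
    then have "emeasure (distr ?P (PiM J (\<lambda>_. M)) ?h) (Pi\<^sub>E J A) = emeasure ?P (Pi\<^sub>E (\<sigma> ` J) ?A')"
      using A by (subst emeasure_distr[OF m]) (auto intro!: sets_PiM_I_finite assms(2))
    also have "\<dots> = (\<Prod>i\<in>\<sigma> ` J. emeasure M (?A' i))"
      using A A' assms(2) by (intro emeasure_PiM) auto
    also have "\<dots> = (\<Prod>j\<in>J. emeasure M (A j))"
      by (subst prod.reindex[OF assms(3)]) (auto intro!: prod.cong simp: A')
    finally show "emeasure (distr ?P (PiM J (\<lambda>_. M)) ?h) (Pi\<^sub>E J A) = (\<Prod>j\<in>J. emeasure M (A j))" .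
  qed (auto simp: assms(2))
qed

lemma nonsingular_reindex:
  assumes "sigma_finite_measure M" "finite J" "finite I" "inj_on \<sigma> J" "\<sigma> ` J \<subseteq> I"
  shows "nonsingular (PiM I (\<lambda>_. M)) (PiM J (\<lambda>_. M)) (\<lambda>x. \<lambda>j\<in>J. x (\<sigma> j))"
  by (rule nonsingular_compose[OF nonsingular_restrict[OF assms(1,3,5)]
        nonsingular_bij_reindex[OF assms(1,2,4)], THEN nonsingular_cong])
     (auto intro!: restrict_ext)

lemma nonsingular_component:
  assumes "sigma_finite_measure M" "finite I" "i \<in> I"
  shows "nonsingular (PiM I (\<lambda>_. M)) M (\<lambda>x. x i)"
proof (rule nonsingularI)
  interpret product_sigma_finite "\<lambda>_. M" by (simp add: product_sigma_finite_def assms(1))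
  fix A assume A: "A \<in> null_sets M"
  have "emeasure (PiM {i} (\<lambda>_. M)) (Pi\<^sub>E {i} (\<lambda>_. A)) = (\<Prod>j\<in>{i}. emeasure M A)"
    using A by (intro emeasure_PiM) auto
  then have "Pi\<^sub>E {i} (\<lambda>_. A) \<in> null_sets (PiM {i} (\<lambda>_. M))"
    using A by (auto simp: null_sets_def intro!: sets_PiM_I_finite)
  then have "AE x in PiM {i} (\<lambda>_. M). x \<notin> Pi\<^sub>E {i} (\<lambda>_. A)"
    by (rule AE_not_in)
  then have "AE x in PiM I (\<lambda>_. M). restrict x {i} \<notin> Pi\<^sub>E {i} (\<lambda>_. A)"
    by (rule nonsingular_AE[rotated]) (rule nonsingular_restrict, use assms in auto)
  then show "AE x in PiM I (\<lambda>_. M). x i \<notin> A"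
    by (auto simp: PiE_iff)
qed (use assms in \<open>auto intro: measurable_component_singleton\<close>)

lemma nonsingular_singleton:
  assumes "sigma_finite_measure M"
  shows "nonsingular M (PiM {i} (\<lambda>_. M)) (\<lambda>x. \<lambda>j\<in>{i}. x)"
proof -
  interpret product_sigma_finite "\<lambda>_. M" by (simp add: product_sigma_finite_def assms(1))
  show ?thesis
    by (rule nonsingular_of_distr[OF _ distr_component]) (auto intro!: measurable_restrict)
qed

lemma nonsingular_two_components:
  assumes "sigma_finite_measure M" "finite I" "i \<in> I" "j \<in> I" "i \<noteq> j"
  shows "nonsingular (PiM I (\<lambda>_. M)) (M \<Otimes>\<^sub>M M) (\<lambda>x. (x i, x j))"
proof -
  note sf = assms(1) sigma_finite_PiM[OF assms(1)]
  have 1: "nonsingular (PiM I (\<lambda>_. M)) (PiM ({i} \<union> {j}) (\<lambda>_. M)) (\<lambda>x. restrict x ({i} \<union> {j}))"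
    using assms by (intro nonsingular_restrict) auto
  have 2: "nonsingular (PiM ({i} \<union> {j}) (\<lambda>_. M)) (PiM {i} (\<lambda>_. M) \<Otimes>\<^sub>M PiM {j} (\<lambda>_. M))
      (\<lambda>x. (restrict x {i}, restrict x {j}))"
    using assms by (intro nonsingular_unmerge) auto
  have 3: "nonsingular (PiM {i} (\<lambda>_. M) \<Otimes>\<^sub>M PiM {j} (\<lambda>_. M)) (M \<Otimes>\<^sub>M M)
      (\<lambda>z. ((fst z) i, (snd z) j))"
    by (intro nonsingular_map_pair nonsingular_component sf) auto
  show ?thesis
    using nonsingular_compose[OF nonsingular_compose[OF 1 2] 3] by simp
qed

text \<open>Base case for \<open>nonsingular_PiM_map\<close>: an empty product is a single point of
  mass 1, whose only null set is empty.\<close>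

lemma nonsingular_PiM_empty: "nonsingular (PiM {} M) (PiM {} N) (\<lambda>x. \<lambda>i\<in>{}. f x i)"
proof (rule nonsingularI)
  fix A assume A: "A \<in> null_sets (PiM {} N)"
  have "A \<noteq> {\<lambda>_. undefined}"
    using A by (auto simp: null_sets_def)
  moreover have "A \<subseteq> {\<lambda>_. undefined}"
    using A sets.sets_into_space[of A "PiM {} N"] by (auto simp: null_sets_def space_PiM)
  ultimately have "A = {}" by auto
  then show "AE x in PiM {} M. (\<lambda>i\<in>{}. f x i) \<notin> A" by simp
qed (auto intro!: measurable_restrict)

lemma nonsingular_PiM_map:
  assumes "sigma_finite_measure M" "sigma_finite_measure N" "finite I" "nonsingular M N f"
  shows "nonsingular (PiM I (\<lambda>_. M)) (PiM I (\<lambda>_. N)) (\<lambda>x. \<lambda>i\<in>I. f (x i))"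
  using assms(3)
proof (induction I)
  case empty
  show ?case by (rule nonsingular_PiM_empty)
next
  case (insert i I)
  note sM = assms(1) sigma_finite_PiM[OF assms(1)] and sN = assms(2) sigma_finite_PiM[OF assms(2)]
  have 1: "nonsingular (PiM ({i} \<union> I) (\<lambda>_. M)) (PiM {i} (\<lambda>_. M) \<Otimes>\<^sub>M PiM I (\<lambda>_. M))
      (\<lambda>x. (restrict x {i}, restrict x I))"
    using insert by (intro nonsingular_unmerge sM) auto
  have 2: "nonsingular (PiM {i} (\<lambda>_. M)) (PiM {i} (\<lambda>_. N)) (\<lambda>x. \<lambda>j\<in>{i}. f (x i))"
    by (rule nonsingular_compose[OF nonsingular_compose[OF nonsingular_component[OF sM(1)] assms(4)]
          nonsingular_singleton[OF sN(1)]]) auto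
  have 3: "nonsingular (PiM {i} (\<lambda>_. M) \<Otimes>\<^sub>M PiM I (\<lambda>_. M)) (PiM {i} (\<lambda>_. N) \<Otimes>\<^sub>M PiM I (\<lambda>_. N))
      (\<lambda>z. (\<lambda>j\<in>{i}. f (fst z i), \<lambda>j\<in>I. f (snd z j)))"
    using insert by (intro nonsingular_map_pair sM sN 2) auto
  have 4: "nonsingular (PiM {i} (\<lambda>_. N) \<Otimes>\<^sub>M PiM I (\<lambda>_. N)) (PiM ({i} \<union> I) (\<lambda>_. N)) (merge {i} I)"
    using insert by (intro nonsingular_merge sN) auto
  have "nonsingular (PiM ({i} \<union> I) (\<lambda>_. M)) (PiM ({i} \<union> I) (\<lambda>_. N)) (\<lambda>x. \<lambda>j\<in>{i} \<union> I. f (x j))"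
    by (rule nonsingular_compose[OF nonsingular_compose[OF 1 3] 4, THEN nonsingular_cong])
       (auto simp: merge_def fun_eq_iff)
  then show ?case by (simp only: insert_is_Un[symmetric])
qed

text \<open>An image of a sigma-finite measure may fail to be sigma-finite. A measurable left
  inverse \<open>g\<close> of \<open>f\<close> transports the exhaustion: the part of
  \<open>N\<close> that \<open>g\<close> sends into a set has the measure of that set.\<close>

lemma sigma_finite_distr_section:
  assumes "sigma_finite_measure M" "f \<in> measurable M N" "g \<in> measurable N M"
    "\<And>x. x \<in> space M \<Longrightarrow> g (f x) = x"
  shows "sigma_finite_measure (distr M N f)"
proof -
  interpret sigma_finite_measure M by fact
  obtain S where S: "countable S" "S \<subseteq> sets M" "\<Union> S = space M" "\<forall>a\<in>S. emeasure M a \<noteq> \<infinity>"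
    using sigma_finite_countable by auto
  show ?thesis
  proof (rule sigma_finite_measure.intro, intro exI conjI)
    let ?T = "(\<lambda>a. g -` a \<inter> space N) ` S"
    show "countable ?T" using S(1) by simp
    show "?T \<subseteq> sets (distr M N f)" using S(2) measurable_sets[OF assms(3)] by auto
    show "\<Union> ?T = space (distr M N f)"
    proof -
      have "\<exists>a\<in>S. g y \<in> a" if "y \<in> space N" for y
        using measurable_space[OF assms(3) that] unfolding S(3)[symmetric] by blast
      then show ?thesis by auto
    qed
    show "\<forall>a\<in>?T. emeasure (distr M N f) a \<noteq> \<infinity>"
    proof safe
      fix a assume a: "a \<in> S" "emeasure (distr M N f) (g -` a \<inter> space N) = \<infinity>"
      have "f -` (g -` a \<inter> space N) \<inter> space M = a"
      proof -
        have "a \<subseteq> space M" using sets.sets_into_space[of a M] S(2) a(1) by auto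
        then show ?thesis using assms(4) measurable_space[OF assms(2)] by auto
      qed
      then have "emeasure (distr M N f) (g -` a \<inter> space N) = emeasure M a"
        using measurable_sets[OF assms(3), of a] S(2) a(1) by (subst emeasure_distr[OF assms(2)]) auto
      then show False using S(4) a by auto
    qed
  qed
qed

section \<open>The special linear group and its Haar measure\<close>

lemma matrix_mult_nth2:
  fixes A B :: "real^2^2"
  shows "(A ** B) $ i $ j = A $ i $ 1 * B $ 1 $ j + A $ i $ 2 * B $ 2 $ j"
  by (simp add: matrix_matrix_mult_def sum_2)

lemma mat2_eq_iff:
  fixes A B :: "'a^2^2"
  shows "A = B \<longleftrightarrow> A$1$1 = B$1$1 \<and> A$1$2 = B$1$2 \<and> A$2$1 = B$2$1 \<and> A$2$2 = B$2$2"
  by (auto simp: vec_eq_iff forall_2)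

lemma SL2_iff: "g \<in> SL2 \<longleftrightarrow> g$1$1 * g$2$2 - g$1$2 * g$2$1 = 1"
  by (simp add: SL2_def det_2)

lemma SL2_mult: "g \<in> SL2 \<Longrightarrow> h \<in> SL2 \<Longrightarrow> g ** h \<in> SL2"
  by (simp add: SL2_def det_mul)

text \<open>The adjugate, which is the inverse on \<open>SL2\<close>. Unlike
  \<open>matrix_inv\<close>, which is a choice operator, it is explicit in the entries, so that
  measurability is immediate.\<close>

definition adj2 :: "real^2^2 \<Rightarrow> real^2^2" where
  "adj2 g = vector [vector [g$2$2, - g$1$2], vector [- g$2$1, g$1$1]]"

lemma adj2_nth [simp]:
  "adj2 g $ 1 $ 1 = g$2$2" "adj2 g $ 1 $ 2 = - g$1$2"
  "adj2 g $ 2 $ 1 = - g$2$1" "adj2 g $ 2 $ 2 = g$1$1"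
  by (simp_all add: adj2_def)

lemma adj2_SL2: "g \<in> SL2 \<Longrightarrow> adj2 g \<in> SL2"
  by (simp add: SL2_iff algebra_simps)

lemma adj2_inverse:
  assumes "g \<in> SL2"
  shows "adj2 g ** g = mat 1" "g ** adj2 g = mat 1"
  using assms by (simp_all add: SL2_iff mat2_eq_iff matrix_mult_nth2 mat_def algebra_simps)

lemma matrix_inv_SL2:
  assumes "g \<in> SL2"
  shows "matrix_inv g = adj2 g"
proof -
  have "g ** matrix_inv g = mat 1 \<and> matrix_inv g ** g = mat 1"
    unfolding matrix_inv_def by (rule someI[of _ "adj2 g"]) (use adj2_inverse[OF assms] in simp)
  then have "(matrix_inv g ** g) ** adj2 g = adj2 g" by (simp add: matrix_mul_lid)
  then show ?thesis
    using adj2_inverse[OF assms] by (simp add: matrix_mul_assoc[symmetric] matrix_mul_rid)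
qed

lemma adj2_cancel:
  assumes "g \<in> SL2"
  shows "adj2 g ** (g ** h) = h" "g ** (adj2 g ** h) = h"
        "(h ** g) ** adj2 g = h" "(h ** adj2 g) ** g = h"
  using adj2_inverse[OF assms]
  by (simp_all add: matrix_mul_assoc matrix_mul_lid)
     (simp_all add: matrix_mul_assoc[symmetric] matrix_mul_rid)

lemma measurable_matrixI:
  assumes "\<And>i j. (\<lambda>x. f x $ i $ j) \<in> borel_measurable M"
  shows "(f :: 'a \<Rightarrow> real^2^2) \<in> borel_measurable M"
  unfolding borel_measurable_euclidean_space[of f]
  using assms by (auto simp: Basis_vec_def inner_axis)

lemma measurable_nth_haar [measurable]: "(\<lambda>g. g $ i $ j) \<in> borel_measurable haar_SL2"
  by (auto simp: haar_SL2_def intro!: measurable_restrict_space1 borel_measurable_continuous_onI continuous_intros)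

lemma space_haar [simp]: "space haar_SL2 = SL2"
  by (simp add: haar_SL2_def space_restrict_space)

lemma measurable_haarI:
  assumes "f \<in> borel_measurable M" "\<And>x. x \<in> space M \<Longrightarrow> f x \<in> SL2"
  shows "f \<in> measurable M haar_SL2"
  unfolding haar_SL2_def using assms by (auto intro!: measurable_restrict_space2)

lemma measurable_mult_SL2 [measurable]:
  assumes f: "f \<in> measurable M haar_SL2" and g: "g \<in> measurable M haar_SL2"
  shows "(\<lambda>x. f x ** g x) \<in> measurable M haar_SL2"
proof (intro measurable_haarI measurable_matrixI)
  note [measurable] = f g
  show "(\<lambda>x. (f x ** g x) $ i $ j) \<in> borel_measurable M" for i j
    unfolding matrix_mult_nth2 by measurable
qed (use measurable_space[OF f] measurable_space[OF g] in \<open>auto intro: SL2_mult\<close>)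

lemma measurable_adj2 [measurable]: "adj2 \<in> measurable haar_SL2 haar_SL2"
proof (intro measurable_haarI measurable_matrixI)
  show "(\<lambda>x. adj2 x $ i $ j) \<in> borel_measurable haar_SL2" for i j
    using exhaust_2[of i] exhaust_2[of j] by auto
qed (simp add: adj2_SL2)

section \<open>Haar null sets as Lebesgue null sets of cones of matrices\<close>

definition det_cone :: "(real^2^2) set" where
  "det_cone = {m. 0 < det m \<and> det m \<le> 1}"

definition to_SL2 :: "real^2^2 \<Rightarrow> real^2^2" where
  "to_SL2 m = m /\<^sub>R sqrt (det m)"

lemma continuous_det2 [continuous_intros]:
  "continuous_on S (\<lambda>m :: real^2^2. det m)"
  unfolding det_2 by (intro continuous_intros)

lemma det_scale2: "det (c *\<^sub>R m :: real^2^2) = c\<^sup>2 * det m"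
  by (simp add: det_2 power2_eq_square algebra_simps)

lemma det_cone_borel [measurable]: "det_cone \<in> sets borel"
proof -
  have [measurable]: "(\<lambda>m :: real^2^2. det m) \<in> borel_measurable borel"
    by (intro borel_measurable_continuous_onI continuous_intros)
  show ?thesis unfolding det_cone_def by measurable
qed

lemma to_SL2_in: "m \<in> det_cone \<Longrightarrow> to_SL2 m \<in> SL2"
  unfolding to_SL2_def det_cone_def SL2_def mem_Collect_eq det_scale2
  by (simp add: power_inverse)

lemma haar_SL2_eq:
  "haar_SL2 = distr (restrict_space lborel det_cone) (restrict_space borel SL2) to_SL2"
  by (simp add: haar_SL2_def det_cone_def to_SL2_def[abs_def])

lemma measurable_to_SL2:
  "to_SL2 \<in> measurable (restrict_space lborel det_cone) (restrict_space borel SL2)"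
proof (rule measurable_restrict_space2)
  have "continuous_on det_cone to_SL2"
    unfolding to_SL2_def[abs_def] det_cone_def by (intro continuous_intros) auto
  then have "to_SL2 \<in> borel_measurable (restrict_space borel det_cone)"
    by (rule borel_measurable_continuous_on_restrict)
  then show "to_SL2 \<in> borel_measurable (restrict_space lborel det_cone)"
    by (subst measurable_cong_sets[OF sets_restrict_space_cong refl]) auto
qed (auto simp: space_restrict_space to_SL2_in)

lemma
  assumes "N \<in> sets haar_SL2"
  shows emeasure_haar: "emeasure haar_SL2 N = emeasure lborel {m\<in>det_cone. to_SL2 m \<in> N}"
    and sets_haar_preimage: "{m\<in>det_cone. to_SL2 m \<in> N} \<in> sets borel"
proof -
  have N: "N \<in> sets (restrict_space borel SL2)" using assms by (simp add: haar_SL2_eq)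
  have eq: "to_SL2 -` N \<inter> space (restrict_space lborel det_cone) = {m\<in>det_cone. to_SL2 m \<in> N}"
    by (auto simp: space_restrict_space)
  have S: "{m\<in>det_cone. to_SL2 m \<in> N} \<in> sets (restrict_space lborel det_cone)"
    using measurable_sets[OF measurable_to_SL2 N] unfolding eq .
  then show "{m\<in>det_cone. to_SL2 m \<in> N} \<in> sets borel"
    by (subst (asm) sets_restrict_space_iff) auto
  show "emeasure haar_SL2 N = emeasure lborel {m\<in>det_cone. to_SL2 m \<in> N}"
    unfolding haar_SL2_eq emeasure_distr[OF measurable_to_SL2 N] eq
    by (rule emeasure_restrict_space) auto
qed

text \<open>Passage to negligible sets in the space of matrices, where the theorem on differentiable
  images of negligible sets applies.\<close>

lemma null_haar_iff:
  assumes "N \<in> sets haar_SL2"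
  shows "N \<in> null_sets haar_SL2 \<longleftrightarrow> negligible {m\<in>det_cone. to_SL2 m \<in> N}"
  using assms emeasure_haar[OF assms] sets_haar_preimage[OF assms]
  by (auto simp: null_sets_def negligible_iff_null_sets null_sets_completion_iff)

text \<open>The cone over the matrices of norm at most n lies in the ball of radius n, because its
  scaling factors are at most 1.\<close>

lemma sigma_finite_haar: "sigma_finite_measure haar_SL2"
proof (rule sigma_finite_measure.intro, intro exI conjI ballI)
  let ?A = "\<lambda>n::nat. {g\<in>space haar_SL2. norm g \<le> n}"
  have [measurable]: "(\<lambda>g. norm g) \<in> borel_measurable haar_SL2"
    by (auto simp: haar_SL2_eq intro!: measurable_restrict_space1)
  show "countable (range ?A)" by simp
  have A: "?A n \<in> sets haar_SL2" for n by measurable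
  then show "range ?A \<subseteq> sets haar_SL2" by blast
  show "\<Union> (range ?A) = space haar_SL2"
    using real_arch_simple by auto
  fix a assume "a \<in> range ?A"
  then obtain n where n: "a = ?A n" by auto
  have "emeasure haar_SL2 a \<le> emeasure lborel (cball (0::real^2^2) (real n))"
    unfolding n
  proof (subst emeasure_haar[OF A], rule emeasure_mono)
    show "{m \<in> det_cone. to_SL2 m \<in> ?A n} \<subseteq> cball 0 (real n)"
    proof
      fix m assume m: "m \<in> {m \<in> det_cone. to_SL2 m \<in> ?A n}"
      then have d: "0 < sqrt (det m)" "sqrt (det m) \<le> 1" and "norm (m /\<^sub>R sqrt (det m)) \<le> n"
        by (auto simp: det_cone_def to_SL2_def)
      then have "norm m / sqrt (det m) \<le> n" by (simp add: divide_inverse mult.commute)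
      then have "norm m \<le> n * sqrt (det m)" using d by (simp add: field_simps)
      also have "\<dots> \<le> real n * 1" using d by (intro mult_left_mono) auto
      finally show "m \<in> cball 0 (real n)" by simp
    qed
  qed auto
  also have "\<dots> < \<infinity>" by (rule emeasure_lborel_cball_finite)
  finally show "emeasure haar_SL2 a \<noteq> \<infinity>" by simp
qed

text \<open>The cone over the whole group contains the nonempty open set of matrices with
  determinant strictly between 0 and 1.\<close>

lemma haar_not_null: "\<not> (AE g in haar_SL2. False)"
proof
  assume "AE g in haar_SL2. False"
  then have "space haar_SL2 \<in> null_sets haar_SL2"
    using AE_iff_null_sets[OF sets.top[of haar_SL2]] by (simp del: space_haar)
  then have "negligible {m\<in>det_cone. to_SL2 m \<in> space haar_SL2}"
    by (subst (asm) null_haar_iff[OF sets.top])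
  moreover have "{m\<in>det_cone. to_SL2 m \<in> space haar_SL2} = det_cone"
    by (auto simp: to_SL2_in)
  moreover let ?U = "{m :: real^2^2. 0 < det m} \<inter> {m. det m < 1}"
  have "?U \<subseteq> det_cone" by (auto simp: det_cone_def)
  ultimately have "negligible ?U" by (auto intro: negligible_subset)
  moreover have "open ?U"
    by (intro open_Int open_Collect_less continuous_intros)
  moreover have "(1/2) *\<^sub>R mat 1 \<in> ?U"
    by (simp add: det_scale2 power2_eq_square)
  ultimately show False using open_not_negligible by blast
qed

text \<open>Selects an actual group element after Fubini has produced a statement for almost every
  one.\<close>

lemma AE_haar_ex:
  assumes "AE g in haar_SL2. P g"
  shows "\<exists>g\<in>SL2. P g"
proof (rule ccontr)
  assume "\<not> ?thesis"
  then have "AE g in haar_SL2. P g \<longrightarrow> False"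
    by (intro AE_I2) auto
  then have "AE g in haar_SL2. False"
    using assms by eventually_elim simp
  then show False using haar_not_null by simp
qed

text \<open>A linear map that preserves determinants commutes with \<open>to_SL2\<close>. Hence the
  cone over the preimage of \<open>N\<close> lies in the image of the cone over \<open>N\<close>
  under the linear map \<open>L'\<close>, which is again negligible.\<close>

lemma nonsingular_haar_linear:
  assumes L: "linear L" "linear L'" "\<And>m. L' (L m) = m" "\<And>m. det (L m) = det m"
  shows "nonsingular haar_SL2 haar_SL2 L"
proof (rule nonsingularI)
  have "L \<in> borel_measurable borel"
    using L(1) by (intro borel_measurable_continuous_onI linear_continuous_on linear_conv_bounded_linear[THEN iffD1])
  then have "L \<in> borel_measurable haar_SL2"
    by (auto simp: haar_SL2_eq intro: measurable_restrict_space1)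
  then show m: "L \<in> measurable haar_SL2 haar_SL2"
    by (rule measurable_haarI) (use L(4) in \<open>simp add: SL2_def\<close>)
  fix N assume N: "N \<in> null_sets haar_SL2"
  let ?S = "{m\<in>det_cone. to_SL2 m \<in> N}"
  let ?T = "L -` N \<inter> space haar_SL2"
  have T: "?T \<in> sets haar_SL2" using N by (intro measurable_sets[OF m]) auto
  have "{m\<in>det_cone. to_SL2 m \<in> ?T} \<subseteq> L' ` ?S"
  proof
    fix m assume m: "m \<in> {m\<in>det_cone. to_SL2 m \<in> ?T}"
    have "L (to_SL2 m) = to_SL2 (L m)"
      by (simp add: to_SL2_def L(4) linear_scale[OF L(1)])
    with m have "L m \<in> ?S" by (auto simp: det_cone_def L(4))
    then show "m \<in> L' ` ?S" by (rule image_eqI[rotated]) (simp add: L(3))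
  qed
  moreover have "negligible (L' ` ?S)"
  proof (rule negligible_differentiable_image_negligible)
    show "negligible ?S" using N null_haar_iff[of N] by auto
    show "L' differentiable_on ?S" by (rule linear_imp_differentiable_on[OF L(2)])
  qed simp
  ultimately have "?T \<in> null_sets haar_SL2"
    using null_haar_iff[OF T] negligible_subset by blast
  then have "AE g in haar_SL2. g \<notin> ?T" by (rule AE_not_in)
  then show "AE g in haar_SL2. L g \<notin> N" by (rule AE_mp) (auto intro!: AE_I2)
qed

lemma linear_matrix_mult:
  fixes k :: "real^2^2"
  shows "linear (\<lambda>m :: real^2^2. k ** m)" "linear (\<lambda>m :: real^2^2. m ** k)"
  by (auto intro!: linearI simp: mat2_eq_iff matrix_mult_nth2 algebra_simps)

lemma
  assumes "k \<in> SL2"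
  shows nonsingular_mult_left: "nonsingular haar_SL2 haar_SL2 (\<lambda>g. k ** g)"
    and nonsingular_mult_right: "nonsingular haar_SL2 haar_SL2 (\<lambda>g. g ** k)"
proof -
  show "nonsingular haar_SL2 haar_SL2 (\<lambda>g. k ** g)"
    by (rule nonsingular_haar_linear[where L' = "\<lambda>g. adj2 k ** g"])
       (use assms in \<open>simp_all add: linear_matrix_mult adj2_cancel det_mul SL2_def\<close>)
  show "nonsingular haar_SL2 haar_SL2 (\<lambda>g. g ** k)"
    by (rule nonsingular_haar_linear[where L' = "\<lambda>g. g ** adj2 k"])
       (use assms in \<open>simp_all add: linear_matrix_mult adj2_cancel det_mul SL2_def\<close>)
qed

section \<open>The torus\<close>

lemma diag2_nth [simp]:
  "diag2 s t $ 1 $ 1 = s" "diag2 s t $ 1 $ 2 = 0" "diag2 s t $ 2 $ 1 = 0" "diag2 s t $ 2 $ 2 = t"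
  by (simp_all add: diag2_def)

lemma torus_iff: "a \<in> torus \<longleftrightarrow> 0 < a$1$1 \<and> a = diag2 (a$1$1) (1 / a$1$1)"
  unfolding torus_def by (auto simp: mat2_eq_iff)

lemma torus_SL2: "a \<in> torus \<Longrightarrow> a \<in> SL2"
  by (auto simp: torus_def SL2_iff)

lemma diag2_torus: "0 < t \<Longrightarrow> diag2 t (1 / t) \<in> torus"
  by (auto simp: torus_def)

lemma diag2_mult: "diag2 s t ** diag2 s' t' = diag2 (s * s') (t * t')"
  by (simp add: mat2_eq_iff matrix_mult_nth2)

lemma torus_mult_nth: "a \<in> torus \<Longrightarrow> (a ** (b :: real^2^2)) $ 1 $ j = a$1$1 * b$1$j"
  by (auto simp: torus_def matrix_mult_nth2)

lemma torus_mult: "a \<in> torus \<Longrightarrow> b \<in> torus \<Longrightarrow> a ** b \<in> torus"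
  by (auto simp: torus_iff matrix_mult_nth2 mat2_eq_iff)

lemma torus_mult_commute: "a \<in> torus \<Longrightarrow> b \<in> torus \<Longrightarrow> a ** b = b ** a"
  by (auto simp: torus_def diag2_mult mult.commute)

lemma torus_pos: "a \<in> torus \<Longrightarrow> 0 < a$1$1"
  by (auto simp: torus_def)

lemma space_haar_torus [simp]: "space haar_torus = torus"
  by (simp add: haar_torus_def space_restrict_space)

lemma measurable_torusI:
  assumes "\<And>i j. (\<lambda>x. f x $ i $ j) \<in> borel_measurable M" "\<And>x. x \<in> space M \<Longrightarrow> f x \<in> torus"
  shows "f \<in> measurable M haar_torus"
  unfolding haar_torus_def using assms by (auto intro!: measurable_restrict_space2 measurable_matrixI)

lemma measurable_nth_torus [measurable]: "(\<lambda>g. g $ i $ j) \<in> borel_measurable haar_torus"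
  by (auto simp: haar_torus_def intro!: measurable_restrict_space1 borel_measurable_continuous_onI continuous_intros)

lemma measurable_diag2:
  assumes "(\<lambda>x. u x :: real) \<in> borel_measurable M" "\<And>x. x \<in> space M \<Longrightarrow> 0 < u x"
  shows "(\<lambda>x. diag2 (u x) (1 / u x)) \<in> measurable M haar_torus"
proof (rule measurable_torusI)
  show "(\<lambda>x. diag2 (u x) (1 / u x) $ i $ j) \<in> borel_measurable M" for i j
    using exhaust_2[of i] exhaust_2[of j] assms(1) by auto
qed (use assms(2) in \<open>auto intro: diag2_torus\<close>)

lemma measurable_mult_torus [measurable]:
  assumes f: "f \<in> measurable M haar_torus" and g: "g \<in> measurable M haar_torus"
  shows "(\<lambda>x. f x ** g x) \<in> measurable M haar_torus"
proof (intro measurable_torusI)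
  note [measurable] = f g
  show "(\<lambda>x. (f x ** g x) $ i $ j) \<in> borel_measurable M" for i j
    unfolding matrix_mult_nth2 by measurable
qed (use measurable_space[OF f] measurable_space[OF g] in \<open>auto intro: torus_mult\<close>)

abbreviation exp_torus :: "real \<Rightarrow> real^2^2" where
  "exp_torus t \<equiv> diag2 (exp t) (exp (- t))"

lemma measurable_exp_torus: "exp_torus \<in> measurable lborel (restrict_space borel torus)"
proof -
  have "(\<lambda>t. diag2 (exp t) (1 / exp t)) \<in> measurable lborel haar_torus"
    by (rule measurable_diag2) auto
  then show ?thesis
    by (simp add: haar_torus_def exp_minus field_simps inverse_eq_divide)
qed

lemma exp_torus_ln: "a \<in> torus \<Longrightarrow> exp_torus (ln (a$1$1)) = a"
  by (auto simp: torus_def exp_minus field_simps)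

lemma sigma_finite_torus: "sigma_finite_measure haar_torus"
  unfolding haar_torus_def
  by (rule sigma_finite_distr_section[where g = "\<lambda>a. ln (a$1$1)"])
     (use measurable_exp_torus measurable_nth_torus in \<open>auto simp: haar_torus_def sigma_finite_lborel\<close>)

lemma AE_torus_iff:
  assumes "A \<in> sets haar_torus"
  shows "(AE a in haar_torus. a \<notin> A) \<longleftrightarrow> (AE t in lborel. exp_torus t \<notin> A)"
proof -
  have "{x \<in> space (restrict_space borel torus). x \<notin> A} = space (restrict_space borel torus) - A"
    by auto
  then show ?thesis
    using assms unfolding haar_torus_def
    by (subst AE_distr_iff[OF measurable_exp_torus]) auto
qed

lemma nonsingular_torus_mult:
  assumes "a \<in> torus"
  shows "nonsingular haar_torus haar_torus (\<lambda>b. a ** b)"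
proof (rule nonsingularI)
  show m: "(\<lambda>b. a ** b) \<in> measurable haar_torus haar_torus"
    using assms by (intro measurable_mult_torus) auto
  fix N assume N: "N \<in> null_sets haar_torus"
  let ?T = "(\<lambda>b. a ** b) -` N \<inter> space haar_torus"
  have T: "?T \<in> sets haar_torus" using N by (intro measurable_sets[OF m]) auto
  \<comment> \<open>In the logarithmic coordinate, multiplication by \<open>a\<close> is translation
    by \<open>s\<close>, which preserves Lebesgue measure.\<close>
  define s where "s = ln (a$1$1)"
  have "AE t in lborel. exp_torus t \<notin> N"
    using AE_torus_iff[of N] AE_not_in[OF N] N by auto
  then have "AE t in distr lborel borel ((+) s). exp_torus t \<notin> N"
    unfolding lborel_distr_plus .
  then have "AE t in lborel. exp_torus (s + t) \<notin> N"
    by (rule AE_distrD[rotated]) simp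
  moreover have "exp_torus (s + t) = a ** exp_torus t" for t
    using exp_torus_ln[OF assms] diag2_mult[of "exp s" "exp (- s)" "exp t" "exp (- t)"]
    by (simp add: s_def exp_add exp_diff exp_minus field_simps)
  ultimately have "AE t in lborel. exp_torus t \<notin> ?T" by auto
  then have "AE b in haar_torus. b \<notin> ?T" using AE_torus_iff[OF T] by auto
  then show "AE b in haar_torus. a ** b \<notin> N" by (rule AE_mp) (auto intro!: AE_I2)
qed

section \<open>The projective line\<close>

text \<open>The generating family is already a sigma-algebra, so that generation adds no further
  sets.\<close>

lemma sets_P1: "S \<in> sets P1_measure \<longleftrightarrow> Pt -` S \<in> sets borel"
proof -
  let ?A = "{S. Pt -` S \<in> sets (borel :: real measure)}"
  have "sigma_sets UNIV ?A \<subseteq> ?A"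
  proof
    fix S assume "S \<in> sigma_sets UNIV ?A"
    then show "S \<in> ?A"
    proof induction
      case (Compl a)
      have "Pt -` (UNIV - a) = UNIV - Pt -` a" by auto
      then show ?case using Compl by auto
    next
      case (Union a)
      then show ?case by (auto simp: vimage_UN)
    qed auto
  qed
  then have "sigma_sets UNIV ?A = ?A" by auto
  then show ?thesis by (simp add: P1_measure_def)
qed

lemma space_P1 [simp]: "space P1_measure = UNIV"
  by (simp add: P1_measure_def space_measure_of_conv)

lemma measurable_Pt [measurable]: "Pt \<in> measurable borel P1_measure"
  by (rule measurableI) (auto simp: sets_P1)

lemma measurable_from_P1:
  assumes "(\<lambda>t. f (Pt t)) \<in> measurable borel N" "f Infty \<in> space N"
  shows "f \<in> measurable P1_measure N"
proof (rule measurableI)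
  show "f x \<in> space N" for x
    using assms measurable_space[OF assms(1)] by (cases x) auto
  fix S assume "S \<in> sets N"
  then have "(\<lambda>t. f (Pt t)) -` S \<inter> space borel \<in> sets borel"
    by (rule measurable_sets[OF assms(1)])
  moreover have "Pt -` (f -` S) = (\<lambda>t. f (Pt t)) -` S" by auto
  ultimately show "f -` S \<inter> space P1_measure \<in> sets P1_measure"
    by (simp add: sets_P1)
qed

lemma measurable_hcoord [measurable]:
  "(\<lambda>x. fst (hcoord x)) \<in> borel_measurable P1_measure"
  "(\<lambda>x. snd (hcoord x)) \<in> borel_measurable P1_measure"
  by (rule measurable_from_P1; simp)+

lemma measurable_bracket [measurable]:
  assumes [measurable]: "f \<in> measurable M P1_measure" "g \<in> measurable M P1_measure"
  shows "(\<lambda>x. bracket (f x) (g x)) \<in> borel_measurable M"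
  unfolding bracket_def by measurable

lemma measurable_cross_ratio [measurable]:
  assumes [measurable]: "f \<in> measurable M P1_measure" "g \<in> measurable M P1_measure"
    "f' \<in> measurable M P1_measure" "g' \<in> measurable M P1_measure"
  shows "(\<lambda>x. cross_ratio (f x) (g x) (f' x) (g' x)) \<in> borel_measurable M"
  unfolding cross_ratio_def by measurable

text \<open>The point with homogeneous coordinates (u : v); the meaningless pair (0, 0) falls to
  \<open>Infty\<close>.\<close>

definition mk_P1 :: "real \<Rightarrow> real \<Rightarrow> P1" where
  "mk_P1 u v = (if v = 0 then Infty else Pt (u / v))"

lemma measurable_mk_P1 [measurable]:
  assumes [measurable]: "u \<in> borel_measurable M" "v \<in> borel_measurable M"
  shows "(\<lambda>x. mk_P1 (u x) (v x)) \<in> measurable M P1_measure"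
  unfolding mk_P1_def by measurable

lemma mk_P1_scale: "l \<noteq> 0 \<Longrightarrow> mk_P1 (l * u) (l * v) = mk_P1 u v"
  by (simp add: mk_P1_def)

lemma mk_P1_hcoord [simp]: "mk_P1 (fst (hcoord x)) (snd (hcoord x)) = x"
  by (cases x) (simp_all add: mk_P1_def)

lemma hcoord_nonzero: "fst (hcoord x) \<noteq> 0 \<or> snd (hcoord x) \<noteq> 0"
  by (cases x) simp_all

lemma hcoord_mk_P1:
  assumes "u \<noteq> 0 \<or> v \<noteq> 0"
  obtains l where "l \<noteq> 0" "hcoord (mk_P1 u v) = (l * u, l * v)"
proof (cases "v = 0")
  case True
  then show ?thesis using assms that[of "inverse u"] by (simp add: mk_P1_def)
next
  case False
  then show ?thesis using that[of "inverse v"] by (simp add: mk_P1_def divide_inverse)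
qed

text \<open>Treats the finite points and infinity by one formula, so that measurability and
  composition need no case distinction.\<close>

lemma mobius_eq_mk_P1:
  "mobius g x = mk_P1 (g$1$1 * fst (hcoord x) + g$1$2 * snd (hcoord x))
                      (g$2$1 * fst (hcoord x) + g$2$2 * snd (hcoord x))"
  by (cases x) (simp_all add: mk_P1_def)

lemma SL2_vec_nonzero:
  assumes "g \<in> SL2" "u \<noteq> 0 \<or> v \<noteq> 0"
  shows "g$1$1 * u + g$1$2 * v \<noteq> 0 \<or> g$2$1 * u + g$2$2 * v \<noteq> 0"
proof (rule ccontr)
  assume *: "\<not> ?thesis"
  have "(g$1$1 * g$2$2 - g$1$2 * g$2$1) * u =
      g$2$2 * (g$1$1 * u + g$1$2 * v) - g$1$2 * (g$2$1 * u + g$2$2 * v)"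
    "(g$1$1 * g$2$2 - g$1$2 * g$2$1) * v =
      g$1$1 * (g$2$1 * u + g$2$2 * v) - g$2$1 * (g$1$1 * u + g$1$2 * v)"
    by algebra+
  then have "u = 0" "v = 0" using * assms(1) unfolding SL2_iff by auto
  then show False using assms(2) by simp
qed

lemma hcoord_mobius:
  assumes "g \<in> SL2"
  obtains l where "l \<noteq> 0"
    "fst (hcoord (mobius g x)) = l * (g$1$1 * fst (hcoord x) + g$1$2 * snd (hcoord x))"
    "snd (hcoord (mobius g x)) = l * (g$2$1 * fst (hcoord x) + g$2$2 * snd (hcoord x))"
  unfolding mobius_eq_mk_P1
  by (rule hcoord_mk_P1[OF SL2_vec_nonzero[OF assms hcoord_nonzero[of x]]]) (use that in simp)

lemma measurable_mobius [measurable]: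
  assumes [measurable]: "g \<in> measurable M haar_SL2" "f \<in> measurable M P1_measure"
  shows "(\<lambda>x. mobius (g x) (f x)) \<in> measurable M P1_measure"
  unfolding mobius_eq_mk_P1 by measurable

lemma mobius_mult:
  assumes "h \<in> SL2"
  shows "mobius (g ** h) x = mobius g (mobius h x)"
proof -
  obtain l where l: "l \<noteq> 0"
    "fst (hcoord (mobius h x)) = l * (h$1$1 * fst (hcoord x) + h$1$2 * snd (hcoord x))"
    "snd (hcoord (mobius h x)) = l * (h$2$1 * fst (hcoord x) + h$2$2 * snd (hcoord x))"
    by (rule hcoord_mobius[OF assms])
  show ?thesis
    unfolding mobius_eq_mk_P1[of g] mobius_eq_mk_P1[of "g ** h"] l(2,3)
    by (subst mk_P1_scale[OF l(1), symmetric]) (simp add: matrix_mult_nth2 algebra_simps)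
qed

lemma mobius_one [simp]: "mobius (mat 1) x = x"
  by (cases x) (simp_all add: mat_def)

lemma mobius_adj2: "g \<in> SL2 \<Longrightarrow> mobius g (mobius (adj2 g) x) = x" "g \<in> SL2 \<Longrightarrow> mobius (adj2 g) (mobius g x) = x"
  by (simp_all add: mobius_mult[symmetric] adj2_SL2 adj2_inverse)

lemma bracket_eq_0_iff: "bracket x y = 0 \<longleftrightarrow> x = y"
  by (cases x; cases y) (auto simp: bracket_def)

text \<open>\<open>bracket\<close> is the determinant of two coordinate vectors, so
  \<open>det g = 1\<close> leaves only the factors by which the normalised coordinates are rescaled.
  They are returned as one function \<open>l\<close> of the point, so that a point occurring in
  several brackets carries the same factor in each.\<close>

lemma bracket_mobius:
  assumes "g \<in> SL2"
  obtains l where "\<And>x. l x \<noteq> 0" "\<And>x y. bracket (mobius g x) (mobius g y) = l x * l y * bracket x y"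
    "\<And>x. fst (hcoord (mobius g x)) = l x * (g$1$1 * fst (hcoord x) + g$1$2 * snd (hcoord x))"
    "\<And>x. snd (hcoord (mobius g x)) = l x * (g$2$1 * fst (hcoord x) + g$2$2 * snd (hcoord x))"
proof -
  have "\<forall>x. \<exists>l. l \<noteq> 0 \<and>
    fst (hcoord (mobius g x)) = l * (g$1$1 * fst (hcoord x) + g$1$2 * snd (hcoord x)) \<and>
    snd (hcoord (mobius g x)) = l * (g$2$1 * fst (hcoord x) + g$2$2 * snd (hcoord x))"
    using hcoord_mobius[OF assms] by metis
  then obtain l where l: "\<And>x. l x \<noteq> 0"
    "\<And>x. fst (hcoord (mobius g x)) = l x * (g$1$1 * fst (hcoord x) + g$1$2 * snd (hcoord x))"
    "\<And>x. snd (hcoord (mobius g x)) = l x * (g$2$1 * fst (hcoord x) + g$2$2 * snd (hcoord x))"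
    by metis
  have "bracket (mobius g x) (mobius g y) =
      l x * l y * ((g$1$1 * g$2$2 - g$1$2 * g$2$1) * bracket x y)" for x y
    unfolding bracket_def l by algebra
  then show ?thesis
    using that[of l] l assms by (simp add: SL2_iff)
qed

lemma cross_ratio_mobius:
  assumes "g \<in> SL2"
  shows "cross_ratio (mobius g a) (mobius g b) (mobius g c) (mobius g d) = cross_ratio a b c d"
proof -
  obtain l where "\<And>x. l x \<noteq> 0"
    "\<And>x y. bracket (mobius g x) (mobius g y) = l x * l y * bracket x y"
    using bracket_mobius[OF assms] by metis
  then show ?thesis
    by (simp add: cross_ratio_def)
qed

section \<open>Null sets of the projective line\<close>

lemma P1_measure_lborel: "P1_measure = distr lborel P1_measure Pt"
  unfolding P1_measure_def by (rule distr_cong) (auto simp: sets_eq_imp_space_eq)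

lemma null_P1_iff:
  assumes "N \<in> sets P1_measure"
  shows "N \<in> null_sets P1_measure \<longleftrightarrow> negligible (Pt -` N)"
proof -
  have "emeasure P1_measure N = emeasure lborel (Pt -` N)"
    using assms by (subst P1_measure_lborel) (simp add: emeasure_distr)
  then show ?thesis
    using assms by (auto simp: null_sets_def negligible_iff_null_sets null_sets_completion_iff sets_P1)
qed

lemma AE_P1_neq: "AE x in P1_measure. x \<noteq> p"
proof -
  have "Pt -` {p} \<subseteq> {fst (hcoord p)}" by auto
  then have "finite (Pt -` {p})" by (auto intro: finite_subset)
  then have "{p} \<in> null_sets P1_measure"
    by (subst null_P1_iff) (simp_all add: sets_P1 negligible_finite borel_closed finite_imp_closed)
  then show ?thesis using AE_not_in by fastforce
qed

lemma sigma_finite_P1: "sigma_finite_measure P1_measure"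
  by (subst P1_measure_lborel, rule sigma_finite_distr_section[where g = "\<lambda>x. fst (hcoord x)"])
     (auto simp: sigma_finite_lborel)

lemma nonsingular_mobius:
  assumes g: "g \<in> SL2"
  shows "nonsingular P1_measure P1_measure (mobius g)"
proof (rule nonsingularI)
  show m: "mobius g \<in> measurable P1_measure P1_measure"
    using assms by (intro measurable_mobius) auto
  fix N assume N: "N \<in> null_sets P1_measure"
  let ?T = "mobius g -` N \<inter> space P1_measure"
  have T: "?T \<in> sets P1_measure" using N by (intro measurable_sets[OF m]) auto
  \<comment> \<open>\<open>?f\<close> is the inverse transformation \<open>mobius (adj2 g)\<close>
    in the affine coordinate, and \<open>?S\<close> leaves out its pole. The only t not reached from
    a finite point is one that \<open>g\<close> sends to infinity; the set added to the image below
    covers it and has at most one element.\<close>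
  let ?f = "\<lambda>t. (g$2$2 * t - g$1$2) / (- g$2$1 * t + g$1$1)"
  let ?S = "Pt -` N \<inter> {t. - g$2$1 * t + g$1$1 \<noteq> 0}"
  have "Pt -` ?T \<subseteq> ?f ` ?S \<union> {t. mobius (adj2 g) Infty = Pt t}"
  proof
    fix t assume t: "t \<in> Pt -` ?T"
    have inv: "mobius (adj2 g) (mobius g (Pt t)) = Pt t" by (rule mobius_adj2(2)[OF g])
    show "t \<in> ?f ` ?S \<union> {t. mobius (adj2 g) Infty = Pt t}"
    proof (cases "mobius g (Pt t)")
      case Infty
      then show ?thesis using inv by auto
    next
      case (Pt s)
      then have "- g$2$1 * s + g$1$1 \<noteq> 0" "t = ?f s" using inv by (auto split: if_splits)
      moreover have "s \<in> Pt -` N" using t Pt by simp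
      ultimately show ?thesis by blast
    qed
  qed
  moreover have "negligible (?f ` ?S)"
  proof (rule negligible_differentiable_image_negligible)
    have "negligible (Pt -` N)" using N null_P1_iff[of N] by auto
    then show "negligible ?S" by (rule negligible_subset) auto
    show "?f differentiable_on ?S"
      unfolding differentiable_on_def by (auto intro!: derivative_intros)
  qed simp
  moreover have "{t. mobius (adj2 g) Infty = Pt t} \<subseteq> {fst (hcoord (mobius (adj2 g) Infty))}"
    by auto
  then have "negligible {t. mobius (adj2 g) Infty = Pt t}"
    by (rule negligible_subset[rotated]) simp
  ultimately have "negligible (Pt -` ?T)"
    using negligible_Un negligible_subset by blast
  then have "?T \<in> null_sets P1_measure" using null_P1_iff[OF T] by simp
  then have "AE x in P1_measure. x \<notin> ?T" by (rule AE_not_in)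
  then show "AE x in P1_measure. mobius g x \<notin> N" by simp
qed

section \<open>Pairs of points\<close>

lemma sigma_finite_pairs: "sigma_finite_measure pairs"
  unfolding pairs_def by (intro sigma_finite_pair sigma_finite_P1)

lemma space_pairs [simp]: "space pairs = UNIV"
  by (simp add: pairs_def space_pair_measure)

lemma measurable_fst_pairs [measurable]: "fst \<in> measurable pairs P1_measure"
  and measurable_snd_pairs [measurable]: "snd \<in> measurable pairs P1_measure"
  by (simp_all add: pairs_def)

lemma measurable_mobius_pair [measurable]:
  assumes [measurable]: "g \<in> measurable M haar_SL2" "f \<in> measurable M pairs"
  shows "(\<lambda>x. mobius_pair (g x) (f x)) \<in> measurable M pairs"
proof -
  have "(\<lambda>x. (mobius (g x) (fst (f x)), mobius (g x) (snd (f x)))) \<in>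
      measurable M (P1_measure \<Otimes>\<^sub>M P1_measure)"
    by measurable
  then show ?thesis by (simp add: mobius_pair_def pairs_def)
qed

lemma mobius_pair_mult: "h \<in> SL2 \<Longrightarrow> mobius_pair (g ** h) x = mobius_pair g (mobius_pair h x)"
  by (simp add: mobius_pair_def mobius_mult)

lemma mobius_pair_adj2:
  "g \<in> SL2 \<Longrightarrow> mobius_pair g (mobius_pair (adj2 g) x) = x"
  "g \<in> SL2 \<Longrightarrow> mobius_pair (adj2 g) (mobius_pair g x) = x"
  by (simp_all add: mobius_pair_def mobius_adj2)

lemma nonsingular_mobius_pair: "g \<in> SL2 \<Longrightarrow> nonsingular pairs pairs (mobius_pair g)"
  unfolding pairs_def mobius_pair_def
  by (intro nonsingular_map_pair sigma_finite_P1 nonsingular_mobius)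

lemma nonsingular_fst_pairs: "nonsingular pairs P1_measure fst"
  and nonsingular_snd_pairs: "nonsingular pairs P1_measure snd"
  unfolding pairs_def by (intro nonsingular_fst nonsingular_snd sigma_finite_P1)+

lemma AE_P1_pair_neq: "AE z in P1_measure \<Otimes>\<^sub>M P1_measure. fst z \<noteq> snd z"
proof (rule AE_pairI[OF sigma_finite_P1 sigma_finite_P1])
  \<comment> \<open>The bracket vanishes exactly on the diagonal, which makes the diagonal
    measurable.\<close>
  have "{z \<in> space (P1_measure \<Otimes>\<^sub>M P1_measure). bracket (fst z) (snd z) \<noteq> 0}
      \<in> sets (P1_measure \<Otimes>\<^sub>M P1_measure)"
    by measurable
  then show "{z \<in> space (P1_measure \<Otimes>\<^sub>M P1_measure). fst z \<noteq> snd z}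
      \<in> sets (P1_measure \<Otimes>\<^sub>M P1_measure)"
    by (simp add: bracket_eq_0_iff)
  show "AE x in P1_measure. AE y in P1_measure. fst (x, y) \<noteq> snd (x, y)"
  proof (rule AE_I2)
    fix x
    show "AE y in P1_measure. fst (x, y) \<noteq> snd (x, y)"
      using AE_P1_neq[of x] by eventually_elim auto
  qed
qed

lemma AE_pairs_neq: "AE x in pairs. fst x \<noteq> snd x"
  unfolding pairs_def by (rule AE_P1_pair_neq)

text \<open>A measurable section of \<open>coset_pair\<close> off the diagonal: the columns are
  homogeneous coordinates of the two points, the first divided by their bracket to make the
  determinant 1. The value \<open>mat 1\<close> on the diagonal keeps \<open>frame\<close> inside
  \<open>SL2\<close> everywhere.\<close>

definition frame :: "P1 \<times> P1 \<Rightarrow> real^2^2" where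
  "frame x = (let B = bracket (fst x) (snd x) in
     if B = 0 then mat 1
     else vector [vector [fst (hcoord (fst x)) / B, fst (hcoord (snd x))],
                  vector [snd (hcoord (fst x)) / B, snd (hcoord (snd x))]])"

lemma frame_nth:
  assumes "fst x \<noteq> snd x"
  shows "frame x $ 1 $ 1 = fst (hcoord (fst x)) / bracket (fst x) (snd x)"
    "frame x $ 1 $ 2 = fst (hcoord (snd x))"
    "frame x $ 2 $ 1 = snd (hcoord (fst x)) / bracket (fst x) (snd x)"
    "frame x $ 2 $ 2 = snd (hcoord (snd x))"
  using assms by (simp_all add: frame_def bracket_eq_0_iff Let_def)

lemma frame_SL2: "frame x \<in> SL2"
proof (cases "fst x = snd x")
  case True
  then show ?thesis by (simp add: frame_def bracket_eq_0_iff SL2_def)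
next
  case False
  then have "bracket (fst x) (snd x) / bracket (fst x) (snd x) = 1"
    by (simp add: bracket_eq_0_iff)
  moreover have "u / B * v' - u' * (v / B) = (u * v' - v * u') / B" for u v u' v' B :: real
    by (simp add: diff_divide_distrib mult.commute)
  ultimately show ?thesis
    unfolding SL2_iff frame_nth[OF False] by (simp add: bracket_def)
qed

lemma coset_pair_frame:
  assumes "fst x \<noteq> snd x"
  shows "coset_pair (frame x) = x"
proof -
  have B: "bracket (fst x) (snd x) \<noteq> 0" using assms by (simp add: bracket_eq_0_iff)
  have "mobius (frame x) Infty = fst x"
    unfolding mobius_eq_mk_P1 frame_nth[OF assms]
    using mk_P1_scale[of "1 / bracket (fst x) (snd x)" "fst (hcoord (fst x))" "snd (hcoord (fst x))"] B
    by simp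
  moreover have "mobius (frame x) (Pt 0) = snd x"
    unfolding mobius_eq_mk_P1 frame_nth[OF assms] by simp
  ultimately show ?thesis by (simp add: coset_pair_def mobius_pair_def)
qed

lemma measurable_frame [measurable]: "frame \<in> measurable pairs haar_SL2"
proof (intro measurable_haarI measurable_matrixI)
  have "(\<lambda>x. frame x $ i $ j) = (\<lambda>x. if bracket (fst x) (snd x) = 0 then mat 1 $ i $ j else
      (if i = 1 then (if j = 1 then fst (hcoord (fst x)) / bracket (fst x) (snd x) else fst (hcoord (snd x)))
       else (if j = 1 then snd (hcoord (fst x)) / bracket (fst x) (snd x) else snd (hcoord (snd x)))))" for i j
    using exhaust_2[of i] exhaust_2[of j] by (auto simp: fun_eq_iff frame_def Let_def)
  then show "(\<lambda>x. frame x $ i $ j) \<in> borel_measurable pairs" for i j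
    by simp
qed (simp add: frame_SL2)

text \<open>The sign of \<open>t\<close> is free: the stabiliser of the base point is the torus
  times {1, -1}, so a pair determines the coset of h only up to replacing h by -h.\<close>

lemma stabiliser_diagonal:
  assumes "g \<in> SL2" "mobius_pair g (Infty, Pt 0) = (Infty, Pt 0)"
  obtains t where "t \<noteq> 0" "g = diag2 t (1 / t)"
proof -
  have "g$2$1 = 0" "g$1$2 = 0"
    using assms by (auto simp: mobius_pair_def SL2_iff split: if_splits)
  then have "g$1$1 * g$2$2 = 1" using assms by (simp add: SL2_iff)
  moreover from this have "g$1$1 \<noteq> 0" by auto
  ultimately have "g = diag2 (g$1$1) (1 / g$1$1)"
    using \<open>g$2$1 = 0\<close> \<open>g$1$2 = 0\<close> by (simp add: mat2_eq_iff field_simps)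
  then show ?thesis using that \<open>g$1$1 \<noteq> 0\<close> by blast
qed

lemma coset_pair_eqE:
  assumes "h \<in> SL2" "h' \<in> SL2" "coset_pair h = coset_pair h'"
  obtains t where "t \<noteq> 0" "h' = h ** diag2 t (1 / t)"
proof -
  have "mobius_pair (adj2 h ** h') (Infty, Pt 0) = (Infty, Pt 0)"
    using mobius_pair_adj2(2)[OF assms(1)] assms(3)[symmetric]
    unfolding mobius_pair_mult[OF assms(2)] by (simp add: coset_pair_def)
  then obtain t where "t \<noteq> 0" "adj2 h ** h' = diag2 t (1 / t)"
    using stabiliser_diagonal assms by (metis adj2_SL2 SL2_mult)
  then show ?thesis using that adj2_cancel(2)[OF assms(1)] by metis
qed

text \<open>The orbit map pulls back non-null sets to non-null sets: this holds for almost every base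
  point by Fubini, and right translations move the base point.\<close>

lemma AE_pairs_from_coset:
  assumes "{x\<in>space pairs. P x} \<in> sets pairs" "AE h in haar_SL2. P (coset_pair h)"
  shows "AE x in pairs. P x"
proof -
  have orbit: "AE h in haar_SL2. P (mobius_pair h x)" if "fst x \<noteq> snd x" for x
  proof -
    have "AE h in haar_SL2. P (coset_pair (h ** frame x))"
      by (rule nonsingular_AE[OF nonsingular_mult_right[OF frame_SL2] assms(2)])
    moreover have "coset_pair (h ** frame x) = mobius_pair h x" for h
      using coset_pair_frame[OF that] frame_SL2[of x] by (simp add: coset_pair_def mobius_pair_mult)
    ultimately show ?thesis by simp
  qed
  have "AE x in pairs. AE h in haar_SL2. P (mobius_pair h x)"
    by (rule eventually_mono[OF AE_pairs_neq orbit])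
  moreover interpret pair_sigma_finite pairs haar_SL2
    by (rule pair_sigma_finiteI[OF sigma_finite_pairs sigma_finite_haar])
  have [measurable]: "Measurable.pred pairs P" using assms(1) by (simp add: pred_def)
  have "{z\<in>space (pairs \<Otimes>\<^sub>M haar_SL2). P (mobius_pair (snd z) (fst z))} \<in> sets (pairs \<Otimes>\<^sub>M haar_SL2)"
    by measurable
  ultimately have "AE h in haar_SL2. AE x in pairs. P (mobius_pair h x)"
    using AE_commute[of "\<lambda>x h. P (mobius_pair h x)"] by blast
  then obtain h where h: "h \<in> SL2" "AE x in pairs. P (mobius_pair h x)"
    using AE_haar_ex by blast
  have "AE x in pairs. P (mobius_pair h (mobius_pair (adj2 h) x))"
    by (rule nonsingular_AE[OF nonsingular_mobius_pair[OF adj2_SL2[OF h(1)]] h(2)])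
  then show ?thesis using mobius_pair_adj2[OF h(1)] by simp
qed

section \<open>Tuples and differentials\<close>

definition tuple1 :: "'x \<Rightarrow> nat \<Rightarrow> 'x" where
  "tuple1 a = (\<lambda>j\<in>{..<1}. a)"

definition tuple2 :: "'x \<Rightarrow> 'x \<Rightarrow> nat \<Rightarrow> 'x" where
  "tuple2 a b = (\<lambda>j\<in>{..<2}. if j = 0 then a else b)"

lemma tuple_nth [simp]: "tuple1 a 0 = a" "tuple2 a b 0 = a" "tuple2 a b (Suc 0) = b"
  by (simp_all add: tuple1_def tuple2_def)

lemma less_2_iff: "(i :: nat) < 2 \<longleftrightarrow> i = 0 \<or> i = Suc 0"
  by auto

lemma face_1: "face 1 0 x = tuple1 (x 1)" "face 1 1 x = tuple1 (x 0)"
  by (auto simp: face_def tuple1_def)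

lemma face_2: "face 2 0 x = tuple2 (x 1) (x 2)" "face 2 1 x = tuple2 (x 0) (x 2)"
    "face 2 2 x = tuple2 (x 0) (x 1)"
  by (auto simp: face_def tuple2_def fun_eq_iff less_2_iff restrict_def numeral_2_eq_2 less_Suc_eq)

lemma hdiff_1: "hdiff 1 f x = f (tuple1 (x 1)) - f (tuple1 (x 0))"
  unfolding face_1[symmetric] by (simp add: hdiff_def)

lemma hdiff_2: "hdiff 2 f x = f (tuple2 (x 1) (x 2)) - f (tuple2 (x 0) (x 2)) + f (tuple2 (x 0) (x 1))"
  unfolding face_2[symmetric] by (simp add: hdiff_def numeral_2_eq_2)

lemma hdiff_3: "hdiff 3 f x = f (face 3 0 x) - f (face 3 1 x) + f (face 3 2 x) - f (face 3 3 x)"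
  by (simp add: hdiff_def numeral_3_eq_3 numeral_2_eq_2)

lemma hdiff_lincomb: "hdiff n (\<lambda>x. a * f x + b * g x) x = a * hdiff n f x + b * hdiff n g x"
  by (simp add: hdiff_def sum_distrib_left sum.distrib algebra_simps)

lemma d_up_0: "d_up 0 f z = f (tuple1 (fst z 1), snd z) - f (tuple1 (fst z 0), snd z)"
  using hdiff_1[of "\<lambda>g. f (g, snd z)" "fst z"] by (simp add: d_up_def)

lemma d_right_11: "d_right 1 1 f z = f (fst z, tuple1 (snd z 1)) - f (fst z, tuple1 (snd z 0))"
  using hdiff_1[of "\<lambda>y. f (fst z, y)" "snd z"] by (simp add: d_right_def)

lemma d_right_01: "d_right 0 1 f z = f (fst z, tuple1 (snd z 0)) - f (fst z, tuple1 (snd z 1))"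
  using hdiff_1[of "\<lambda>y. f (fst z, y)" "snd z"] by (simp add: d_right_def)

lemma d_right_02: "d_right 0 2 f z = - hdiff 2 (\<lambda>y. f (fst z, y)) (snd z)"
  by (simp add: d_right_def)

lemma nonsingular_face:
  assumes "sigma_finite_measure M"
  shows "nonsingular (tuples (Suc n) M) (tuples n M) (face n i)"
  unfolding face_def[abs_def]
  by (rule nonsingular_reindex[OF assms]) (auto simp: inj_on_def split: if_splits)

lemma face_diag_act: "i \<le> n \<Longrightarrow> face n i (diag_act (Suc n) act g x) = diag_act n act g (face n i x)"
  by (auto simp: face_def diag_act_def fun_eq_iff)

lemma nonsingular_tuple1:
  assumes "sigma_finite_measure M"
  shows "nonsingular M (tuples 1 M) tuple1"
proof -
  have "{..<1::nat} = {0}" by auto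
  then show ?thesis
    using nonsingular_singleton[OF assms, of "0 :: nat"] by (simp add: tuple1_def[abs_def])
qed

lemma tuple1_nth_space: "x \<in> space (tuples 1 M) \<Longrightarrow> tuple1 (x 0) = x"
  by (auto simp: space_PiM PiE_iff extensional_def tuple1_def fun_eq_iff)

lemma nonsingular_tuple2:
  assumes "sigma_finite_measure M"
  shows "nonsingular (M \<Otimes>\<^sub>M M) (tuples 2 M) (\<lambda>z. tuple2 (fst z) (snd z))"
proof -
  note sM = assms sigma_finite_PiM[OF assms]
  have 1: "nonsingular (M \<Otimes>\<^sub>M M) (PiM {0 :: nat} (\<lambda>_. M) \<Otimes>\<^sub>M PiM {1 :: nat} (\<lambda>_. M))
      (\<lambda>z. ((\<lambda>j\<in>{0}. fst z), (\<lambda>j\<in>{1}. snd z)))"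
    by (intro nonsingular_map_pair nonsingular_singleton sM) auto
  have "nonsingular (M \<Otimes>\<^sub>M M) (PiM ({0} \<union> {1}) (\<lambda>_. M)) (\<lambda>z. tuple2 (fst z) (snd z))"
    by (rule nonsingular_compose[OF 1 nonsingular_merge[OF assms], THEN nonsingular_cong])
       (auto simp: tuple2_def merge_def fun_eq_iff)
  moreover have "{0} \<union> {1} = {..<2::nat}" by auto
  ultimately show ?thesis by metis
qed

lemma nonsingular_diag_act:
  assumes "sigma_finite_measure M" "nonsingular M M (act g)"
  shows "nonsingular (tuples n M) (tuples n M) (diag_act n act g)"
  unfolding diag_act_def[abs_def] by (rule nonsingular_PiM_map[OF assms(1,1) _ assms(2)]) simp

section \<open>Cochains\<close>

lemma L0_inv_lincomb:
  assumes "f \<in> L0_inv \<Gamma> act M" "g \<in> L0_inv \<Gamma> act M"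
  shows "(\<lambda>x. a * f x + b * g x) \<in> L0_inv \<Gamma> act M"
proof -
  have [measurable]: "f \<in> borel_measurable M" "g \<in> borel_measurable M"
    using assms by (auto simp: L0_inv_def)
  have "AE x in M. a * f (act k x) + b * g (act k x) = a * f x + b * g x" if "k \<in> \<Gamma>" for k
  proof -
    have "AE x in M. f (act k x) = f x" "AE x in M. g (act k x) = g x"
      using assms that by (auto simp: L0_inv_def)
    then show ?thesis by eventually_elim simp
  qed
  then show ?thesis by (simp add: L0_inv_def)
qed

lemma L0_inv_zero: "(\<lambda>x. 0) \<in> L0_inv \<Gamma> act M"
  by (simp add: L0_inv_def)

lemma coboundaries_lincomb:
  assumes "f \<in> coboundaries \<Gamma> act M p" "g \<in> coboundaries \<Gamma> act M p"
  shows "(\<lambda>x. a * f x + b * g x) \<in> coboundaries \<Gamma> act M p"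
proof (cases p)
  case 0
  then show ?thesis
    using assms L0_inv_lincomb[of f \<Gamma> _ _ g a b] by (auto simp: coboundaries_def cochains_def)
next
  case (Suc q)
  then obtain u v where
    u: "u \<in> cochains \<Gamma> act M q" "AE x in tuples (Suc p) M. f x = hdiff p u x" and
    v: "v \<in> cochains \<Gamma> act M q" "AE x in tuples (Suc p) M. g x = hdiff p v x"
    using assms by (auto simp: coboundaries_def)
  have "AE x in tuples (Suc p) M. a * f x + b * g x = hdiff p (\<lambda>x. a * u x + b * v x) x"
    using u(2) v(2) by eventually_elim (simp add: hdiff_lincomb)
  moreover have "(\<lambda>x. a * u x + b * v x) \<in> cochains \<Gamma> act M q"
    using u(1) v(1) unfolding cochains_def by (rule L0_inv_lincomb)
  moreover have "(\<lambda>x. a * f x + b * g x) \<in> cochains \<Gamma> act M p"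
    using assms unfolding coboundaries_def cochains_def by (auto intro: L0_inv_lincomb)
  ultimately show ?thesis
    using Suc by (auto simp: coboundaries_def)
qed

lemma coboundaries_zero: "(\<lambda>x. 0) \<in> coboundaries \<Gamma> act M p"
proof (cases p)
  case 0
  then show ?thesis by (simp add: coboundaries_def cochains_def L0_inv_zero)
next
  case (Suc q)
  have "(\<lambda>x. 0) \<in> cochains \<Gamma> act M q" by (simp add: cochains_def L0_inv_zero)
  then show ?thesis using Suc
    by (auto simp: coboundaries_def cochains_def L0_inv_zero hdiff_def intro!: bexI[of _ "\<lambda>x. 0"])
qed

lemma cohom_class_self: "f \<in> cocycles \<Gamma> act M p \<Longrightarrow> f \<in> cohom_class \<Gamma> act M p f"
  by (simp add: cohom_class_def cohomologous_def coboundaries_zero)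

lemma cohom_class_in: "f \<in> cocycles \<Gamma> act M p \<Longrightarrow> cohom_class \<Gamma> act M p f \<in> cohomology \<Gamma> act M p"
  by (simp add: cohomology_def cohom_class_def quotientI)

lemma cohom_class_eqI:
  assumes "f \<in> cocycles \<Gamma> act M p" "g \<in> cocycles \<Gamma> act M p"
    "(\<lambda>x. g x - f x) \<in> coboundaries \<Gamma> act M p"
  shows "cohom_class \<Gamma> act M p f = cohom_class \<Gamma> act M p g"
proof -
  have "(\<lambda>x. u x - g x) \<in> coboundaries \<Gamma> act M p"
    if "(\<lambda>x. u x - f x) \<in> coboundaries \<Gamma> act M p" for u
    using coboundaries_lincomb[OF that assms(3), of 1 "-1"] by (simp add: algebra_simps)
  moreover have "(\<lambda>x. u x - f x) \<in> coboundaries \<Gamma> act M p"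
    if "(\<lambda>x. u x - g x) \<in> coboundaries \<Gamma> act M p" for u
    using coboundaries_lincomb[OF that assms(3), of 1 1] by (simp add: algebra_simps)
  ultimately show ?thesis
    using assms(1,2) by (auto simp: cohom_class_def cohomologous_def)
qed

lemma AE_tuples_not_null:
  assumes "AE g in tuples (Suc 0) haar_SL2. Q"
  shows Q
  using AE_haar_ex[OF nonsingular_AE[OF nonsingular_tuple1[OF sigma_finite_haar, unfolded One_nat_def] assms]]
  by auto

section \<open>The measure spaces underlying the bicomplex\<close>

lemma sigma_finite_tuples:
  "sigma_finite_measure (tuples n haar_SL2)" "sigma_finite_measure (tuples n pairs)"
  "sigma_finite_measure (tuples n haar_torus)"
  by (simp_all add: sigma_finite_PiM sigma_finite_haar sigma_finite_pairs sigma_finite_torus)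

lemma AE_bispace_snd:
  assumes "AE z in bispace 0 q. P (snd z)"
  shows "AE y in tuples q pairs. P y"
proof -
  have "AE g in tuples (Suc 0) haar_SL2. AE y in tuples q pairs. P (snd (g, y))"
    by (rule AE_pairD[OF sigma_finite_tuples(1,2) assms[unfolded bispace_def]])
  then show ?thesis unfolding snd_conv by (rule AE_tuples_not_null)
qed

lemma nonsingular_biact:
  assumes "k \<in> SL2"
  shows "nonsingular (bispace p q) (bispace p q) (biact p q k)"
  unfolding bispace_def biact_def
  by (intro nonsingular_map_pair sigma_finite_tuples nonsingular_diag_act sigma_finite_haar
      sigma_finite_pairs nonsingular_mult_left[OF assms] nonsingular_mobius_pair[OF assms])

lemma nonsingular_bispace_face:
  "nonsingular (bispace p (Suc q)) (bispace p q) (\<lambda>z. (fst z, face q i (snd z)))"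
  unfolding bispace_def
  by (intro nonsingular_map_pair sigma_finite_tuples nonsingular_ident nonsingular_face sigma_finite_pairs)

lemma nonsingular_bispace_face_fst:
  "nonsingular (bispace (Suc p) q) (bispace p q) (\<lambda>z. (face (Suc p) i (fst z), snd z))"
  unfolding bispace_def
  by (intro nonsingular_map_pair sigma_finite_tuples nonsingular_ident nonsingular_face sigma_finite_haar)

lemma measurable_bispace_fst [measurable]:
  "i < Suc p \<Longrightarrow> (\<lambda>z. fst z i) \<in> measurable (bispace p q) haar_SL2"
  unfolding bispace_def
  by (rule measurable_compose[OF measurable_fst measurable_component_singleton]) simp

lemma measurable_bispace_snd [measurable]:
  "i < q \<Longrightarrow> (\<lambda>z. snd z i) \<in> measurable (bispace p q) pairs"
  unfolding bispace_def
  by (rule measurable_compose[OF measurable_snd measurable_component_singleton]) simp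

lemma space_bispace: "z \<in> space (bispace p q) \<longleftrightarrow>
    fst z \<in> space (tuples (Suc p) haar_SL2) \<and> snd z \<in> space (tuples q pairs)"
  by (cases z) (simp add: bispace_def space_pair_measure)

lemma bispace_SL2: "z \<in> space (bispace p q) \<Longrightarrow> i < Suc p \<Longrightarrow> fst z i \<in> SL2"
  by (auto simp: space_bispace space_PiM PiE_iff)

lemma biact_nth [simp]:
  "i < Suc p \<Longrightarrow> fst (biact p q k z) i = k ** fst z i"
  "j < q \<Longrightarrow> snd (biact p q k z) j = mobius_pair k (snd z j)"
  by (simp_all add: biact_def diag_act_def)

text \<open>Faces are nonsingular and commute with the action, so invariance almost everywhere can
  be pulled back along each of them.\<close>

lemma d_right_01_bicomplex:
  assumes "e \<in> bicomplex 0 1"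
  shows "d_right 0 1 e \<in> bicomplex 0 2"
proof -
  have eq: "d_right 0 1 e = (\<lambda>z. e (fst z, face 1 1 (snd z)) - e (fst z, face 1 0 (snd z)))"
    by (simp add: fun_eq_iff d_right_01[unfolded One_nat_def] face_1[unfolded One_nat_def])
  have m: "e \<in> borel_measurable (bispace 0 1)"
    and inv: "\<And>k. k \<in> SL2 \<Longrightarrow> AE z in bispace 0 1. e (biact 0 1 k z) = e z"
    using assms unfolding bicomplex_def L0_inv_def by blast+
  have ns: "nonsingular (bispace 0 2) (bispace 0 1) (\<lambda>z. (fst z, face 1 i (snd z)))" for i
    using nonsingular_bispace_face[of 0 1 i] by (simp add: numeral_2_eq_2)
  have "(\<lambda>z. e (fst z, face 1 i (snd z))) \<in> borel_measurable (bispace 0 2)" for i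
    by (rule measurable_compose[OF nonsingular_measurable[OF ns] m])
  then have "d_right 0 1 e \<in> borel_measurable (bispace 0 2)"
    unfolding eq by (intro borel_measurable_diff)
  moreover have "AE z in bispace 0 2. d_right 0 1 e (biact 0 2 k z) = d_right 0 1 e z" if k: "k \<in> SL2" for k
  proof -
    have *: "(fst (biact 0 2 k z), face 1 i (snd (biact 0 2 k z))) = biact 0 1 k (fst z, face 1 i (snd z))"
      if "i \<le> 1" for i z
      using face_diag_act[OF that, of mobius_pair k "snd z"] by (simp add: biact_def numeral_2_eq_2)
    have "AE z in bispace 0 2. e (biact 0 1 k (fst z, face 1 i (snd z))) = e (fst z, face 1 i (snd z))" for i
      by (rule nonsingular_AE[OF ns inv[OF k]])
    from this[of 0] this[of 1] show ?thesis
      unfolding eq by eventually_elim (simp only: * le_refl zero_le)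
  qed
  ultimately show ?thesis
    by (simp add: bicomplex_def L0_inv_def)
qed

section \<open>Generic tuples of pairs\<close>

text \<open>In total, the 2n points of the n pairs are pairwise distinct. This keeps every bracket
  whose logarithm is taken away from 0.\<close>

definition generic :: "nat \<Rightarrow> (nat \<Rightarrow> P1 \<times> P1) \<Rightarrow> bool" where
  "generic n w \<longleftrightarrow> (\<forall>i<n. \<forall>j<n. snd (w i) \<noteq> fst (w j) \<and>
     (i \<noteq> j \<longrightarrow> fst (w i) \<noteq> fst (w j) \<and> snd (w i) \<noteq> snd (w j)))"

lemma AE_generic: "AE w in tuples n pairs. generic n w"
proof -
  have *: "AE w in tuples n pairs. p (w i) \<noteq> q (w j)"
    if "i < n" "j < n" "i \<noteq> j" "nonsingular pairs P1_measure p" "nonsingular pairs P1_measure q"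
    for i j and p q :: "P1 \<times> P1 \<Rightarrow> P1"
  proof -
    have "nonsingular (tuples n pairs) (P1_measure \<Otimes>\<^sub>M P1_measure)
        (\<lambda>w. (p (fst (w i, w j)), q (snd (w i, w j))))"
      using that
      by (intro nonsingular_compose[OF nonsingular_two_components nonsingular_map_pair]
            sigma_finite_pairs sigma_finite_P1) auto
    from nonsingular_AE[OF this AE_P1_pair_neq] show ?thesis by simp
  qed
  have d: "AE w in tuples n pairs. snd (w i) \<noteq> fst (w i)" if "i < n" for i
    using nonsingular_AE[OF nonsingular_component[OF sigma_finite_pairs, of "{..<n}" i] AE_pairs_neq] that
    by (auto elim!: eventually_mono)
  have "AE w in tuples n pairs. snd (w i) \<noteq> fst (w j) \<and>
      (i \<noteq> j \<longrightarrow> fst (w i) \<noteq> fst (w j) \<and> snd (w i) \<noteq> snd (w j))"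
    if "i \<in> {..<n}" "j \<in> {..<n}" for i j
  proof (cases "i = j")
    case True
    then show ?thesis using d[of i] that by simp
  next
    case False
    then show ?thesis
      using *[of i j fst fst] *[of i j snd snd] *[of i j snd fst] that
        nonsingular_fst_pairs nonsingular_snd_pairs by auto
  qed
  then have "AE w in tuples n pairs. \<forall>i\<in>{..<n}. \<forall>j\<in>{..<n}. snd (w i) \<noteq> fst (w j) \<and>
      (i \<noteq> j \<longrightarrow> fst (w i) \<noteq> fst (w j) \<and> snd (w i) \<noteq> snd (w j))"
    by (intro AE_finite_allI finite_lessThan)
  then show ?thesis by eventually_elim (simp add: generic_def)
qed

lemma AE_bispace_generic: "AE z in bispace p q. generic q (snd z)"
  unfolding bispace_def
  by (rule nonsingular_AE[OF nonsingular_snd[OF sigma_finite_tuples(1,2)] AE_generic])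

section \<open>Norms of rows\<close>

text \<open>The row (v, -u) is the linear form vanishing on the line of \<open>p\<close>. At
  \<open>Pt 0\<close> it is (1, 0), so that \<open>rnorm (Pt 0) g\<close> is the norm of the first
  row of \<open>g\<close>.\<close>

definition rnorm :: "P1 \<Rightarrow> real^2^2 \<Rightarrow> real" where
  "rnorm p g = sqrt ((snd (hcoord p) * g$1$1 - fst (hcoord p) * g$2$1)\<^sup>2 +
                     (snd (hcoord p) * g$1$2 - fst (hcoord p) * g$2$2)\<^sup>2)"

lemma measurable_rnorm [measurable]:
  assumes [measurable]: "f \<in> measurable M P1_measure" "g \<in> measurable M haar_SL2"
  shows "(\<lambda>x. rnorm (f x) (g x)) \<in> borel_measurable M"
  unfolding rnorm_def by measurable

lemma rnorm_pos:
  assumes "g \<in> SL2"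
  shows "0 < rnorm p g"
proof -
  let ?u = "fst (hcoord p)" and ?v = "snd (hcoord p)"
  have "?v * g$1$1 - ?u * g$2$1 \<noteq> 0 \<or> ?v * g$1$2 - ?u * g$2$2 \<noteq> 0"
  proof (rule ccontr)
    assume *: "\<not> ?thesis"
    have "(g$1$1 * g$2$2 - g$1$2 * g$2$1) * ?v =
        g$2$2 * (?v * g$1$1 - ?u * g$2$1) - g$2$1 * (?v * g$1$2 - ?u * g$2$2)"
      "(g$1$1 * g$2$2 - g$1$2 * g$2$1) * ?u =
        g$1$2 * (?v * g$1$1 - ?u * g$2$1) - g$1$1 * (?v * g$1$2 - ?u * g$2$2)"
      by algebra+
    then have "?v = 0" "?u = 0" using * assms unfolding SL2_iff by auto
    then show False using hcoord_nonzero[of p] by simp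
  qed
  then show ?thesis
    by (auto simp: rnorm_def sum_power2_gt_zero_iff)
qed

text \<open>Because \<open>det k = 1\<close>, the row attached to \<open>mobius k x\<close> is
  \<open>l\<close> times the row of \<open>x\<close> multiplied by the inverse of \<open>k\<close>,
  and this inverse cancels against \<open>k\<close> in \<open>k ** g\<close>.\<close>

lemma rnorm_mobius:
  assumes "k \<in> SL2"
    and "fst (hcoord (mobius k x)) = l * (k$1$1 * fst (hcoord x) + k$1$2 * snd (hcoord x))"
    and "snd (hcoord (mobius k x)) = l * (k$2$1 * fst (hcoord x) + k$2$2 * snd (hcoord x))"
  shows "rnorm (mobius k x) (k ** g) = \<bar>l\<bar> * rnorm x g"
proof -
  have *: "snd (hcoord (mobius k x)) * (k ** g)$1$j - fst (hcoord (mobius k x)) * (k ** g)$2$j =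
      l * (snd (hcoord x) * g$1$j - fst (hcoord x) * g$2$j)" for j
  proof -
    have "l * (k$2$1 * u + k$2$2 * v) * (k$1$1 * g1 + k$1$2 * g2) -
        l * (k$1$1 * u + k$1$2 * v) * (k$2$1 * g1 + k$2$2 * g2) =
        l * ((k$1$1 * k$2$2 - k$1$2 * k$2$1) * (v * g1 - u * g2))" for u v g1 g2 :: real
      by algebra
    then show ?thesis
      using assms(1) unfolding assms(2,3) matrix_mult_nth2 SL2_iff by simp
  qed
  show ?thesis
    unfolding rnorm_def * power_mult_distrib
    by (simp add: distrib_left[symmetric] real_sqrt_mult)
qed

lemma bracket_rnorm_mobius:
  assumes "g \<in> SL2"
  obtains l where "\<And>x. l x \<noteq> 0" "\<And>x y. bracket (mobius g x) (mobius g y) = l x * l y * bracket x y"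
    "\<And>x h. rnorm (mobius g x) (g ** h) = \<bar>l x\<bar> * rnorm x h"
  using bracket_mobius[OF assms] rnorm_mobius[OF assms] by metis

lemma rnorm_diag2: "rnorm (Pt 0) (diag2 s t ** g) = \<bar>s\<bar> * rnorm (Pt 0) g"
  by (simp add: rnorm_def matrix_mult_nth2 power_mult_distrib distrib_left[symmetric] real_sqrt_mult)

text \<open>The second point of the pair is the image of 0 under \<open>h\<close>, so moving back by
  the inverse of \<open>h\<close> leads to the first row of the translated matrix. The factor
  \<open>l\<close> does not depend on \<open>g\<close> and therefore drops out of differences of
  logarithms.\<close>

lemma rnorm_coset:
  assumes h: "h \<in> SL2"
  obtains l where "l \<noteq> 0" "\<And>g. rnorm (snd (coset_pair h)) g = \<bar>l\<bar> * rnorm (Pt 0) (adj2 h ** g)"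
proof -
  obtain l where "\<And>x. l x \<noteq> 0" "\<And>x g. rnorm (mobius h x) (h ** g) = \<bar>l x\<bar> * rnorm x g"
    using bracket_rnorm_mobius[OF h] by metis
  then have l: "l (Pt 0) \<noteq> 0" "rnorm (mobius h (Pt 0)) (h ** (adj2 h ** g)) =
      \<bar>l (Pt 0)\<bar> * rnorm (Pt 0) (adj2 h ** g)" for g
    by blast+
  then show ?thesis
    using that[of "l (Pt 0)"] unfolding adj2_cancel(2)[OF h] coset_pair_def mobius_pair_def by simp
qed

section \<open>The class of the torus cocycle\<close>

definition slope :: "(real^2^2 \<Rightarrow> real) \<Rightarrow> real" where
  "slope \<alpha> = \<alpha> (diag2 1 (- 1))"

lemma alpha_diag2:
  assumes "\<alpha> \<in> lie_torus_dual"
  shows "\<alpha> (diag2 s (- s)) = slope \<alpha> * s"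
proof -
  have "diag2 1 (- 1) \<in> lie_torus" by (auto simp: lie_torus_def)
  then have "\<alpha> (s *\<^sub>R diag2 1 (- 1)) = s * slope \<alpha>"
    using assms by (simp add: lie_torus_dual_def slope_def)
  moreover have "s *\<^sub>R diag2 1 (- 1) = diag2 s (- s)"
    by (simp add: mat2_eq_iff)
  ultimately show ?thesis by simp
qed

lemma alpha_bar_torus:
  assumes "\<alpha> \<in> lie_torus_dual" "a \<in> torus"
  shows "alpha_bar \<alpha> a = slope \<alpha> * ln (a$1$1)"
proof -
  obtain t where t: "0 < t" "a = diag2 t (1 / t)" using assms(2) by (auto simp: torus_def)
  then have "log_torus a = diag2 (ln t) (- ln t)"
    by (simp add: log_torus_def ln_div)
  then show ?thesis using alpha_diag2[OF assms(1), of "ln t"] t by (simp add: alpha_bar_def)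
qed

lemma torus_cocycle_eq:
  assumes "\<alpha> \<in> lie_torus_dual" "a 0 \<in> torus" "a 1 \<in> torus"
  shows "torus_cocycle \<alpha> a = slope \<alpha> * (ln (a 1 $1$1) - ln (a 0 $1$1))"
  using assms by (simp add: torus_cocycle_def alpha_bar_torus right_diff_distrib)

lemma measurable_tuples_nth: "i < n \<Longrightarrow> (\<lambda>x. x i) \<in> measurable (tuples n M) M"
  by (rule measurable_component_singleton) simp

lemma tuples_nth_space: "x \<in> space (tuples n M) \<Longrightarrow> i < n \<Longrightarrow> x i \<in> space M"
  by (auto simp: space_PiM PiE_iff)

lemma cochainsI_pointwise:
  assumes "f \<in> borel_measurable (tuples (Suc p) M)"
    "\<And>g x. g \<in> \<Gamma> \<Longrightarrow> x \<in> space (tuples (Suc p) M) \<Longrightarrow> f (diag_act (Suc p) act g x) = f x"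
  shows "f \<in> cochains \<Gamma> act M p"
  using assms by (auto simp: cochains_def L0_inv_def intro!: AE_I2)

lemma torus_cocycle_invariant:
  assumes "\<alpha> \<in> lie_torus_dual" "a \<in> torus" "x 0 \<in> torus" "x 1 \<in> torus"
  shows "torus_cocycle \<alpha> (diag_act (Suc 1) (**) a x) = torus_cocycle \<alpha> x"
proof -
  have "diag_act (Suc 1) (**) a x i = a ** x i" if "i \<in> {0, 1}" for i
    using that by (auto simp: diag_act_def)
  then show ?thesis
    using assms torus_pos[OF assms(2)] torus_pos[OF assms(3)] torus_pos[OF assms(4)]
    by (simp add: torus_cocycle_eq torus_mult torus_mult_nth ln_mult)
qed

lemma torus_cocycle_measurable:
  assumes "\<alpha> \<in> lie_torus_dual" "u \<in> measurable M haar_torus" "v \<in> measurable M haar_torus"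
    "\<And>x. w x 0 = u x" "\<And>x. w x (Suc 0) = v x"
  shows "(\<lambda>x. torus_cocycle \<alpha> (w x)) \<in> borel_measurable M"
proof -
  note [measurable] = assms(2,3)
  have "(\<lambda>x. slope \<alpha> * (ln (v x $1$1) - ln (u x $1$1))) \<in> borel_measurable M"
    by measurable
  then show ?thesis
    by (rule measurable_cong[THEN iffD1, rotated])
       (use measurable_space[OF assms(2)] measurable_space[OF assms(3)] assms
         in \<open>auto simp: torus_cocycle_eq\<close>)
qed

lemma torus_cocycle_in_cocycles:
  assumes "\<alpha> \<in> lie_torus_dual"
  shows "torus_cocycle \<alpha> \<in> cocycles torus (**) haar_torus 1"
proof -
  have "torus_cocycle \<alpha> \<in> cochains torus (**) haar_torus 1"
  proof (rule cochainsI_pointwise)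
    show "torus_cocycle \<alpha> \<in> borel_measurable (tuples (Suc 1) haar_torus)"
      by (rule torus_cocycle_measurable[OF assms, where u = "\<lambda>x. x 0" and v = "\<lambda>x. x 1"])
         (auto intro!: measurable_tuples_nth)
    show "torus_cocycle \<alpha> (diag_act (Suc 1) (**) a x) = torus_cocycle \<alpha> x"
      if "a \<in> torus" "x \<in> space (tuples (Suc 1) haar_torus)" for a x
      using that assms by (intro torus_cocycle_invariant) (auto simp: space_PiM PiE_iff)
  qed
  moreover have "hdiff (Suc 1) (torus_cocycle \<alpha>) x = 0" for x
    unfolding Suc_1 hdiff_2 by (simp add: torus_cocycle_def)
  ultimately show ?thesis by (simp add: cocycles_def)
qed

text \<open>A 1-coboundary of the torus vanishes, because an invariant function of one variable is
  constant almost everywhere.\<close>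

lemma torus_class_AE:
  assumes "f \<in> cohom_class torus (**) haar_torus 1 f0"
  shows "AE x in tuples 2 haar_torus. f x = f0 x"
proof -
  note sT = sigma_finite_torus
  obtain h where h: "h \<in> cochains torus (**) haar_torus 0"
    and "AE x in tuples (Suc (Suc 0)) haar_torus. f x - f0 x = hdiff (Suc 0) h x"
    using assms by (auto simp: cohom_class_def cohomologous_def coboundaries_def)
  then have fh: "AE x in tuples 2 haar_torus. f x - f0 x = hdiff 1 h x"
    unfolding numeral_2_eq_2 One_nat_def by blast
  define h' where "h' t = h (tuple1 t)" for t
  have hm: "h \<in> borel_measurable (tuples 1 haar_torus)"
    and hinv: "\<And>a. a \<in> torus \<Longrightarrow> AE x in tuples 1 haar_torus. h (diag_act 1 (**) a x) = h x"
    using h unfolding cochains_def L0_inv_def One_nat_def by blast+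
  have [measurable]: "h' \<in> borel_measurable haar_torus"
    unfolding h'_def[abs_def]
    by (rule measurable_compose[OF nonsingular_measurable[OF nonsingular_tuple1[OF sT]] hm])
  have "AE t in haar_torus. h' (a ** t) = h' t" if "a \<in> torus" for a
  proof -
    have "diag_act 1 (**) a (tuple1 t) = tuple1 (a ** t)" for t :: "real^2^2"
      by (auto simp: diag_act_def tuple1_def fun_eq_iff)
    with nonsingular_AE[OF nonsingular_tuple1[OF sT] hinv[OF that]] show ?thesis
      unfolding h'_def by simp
  qed
  then have "AE a in haar_torus. AE t in haar_torus. h' (a ** t) = h' t"
    by (rule AE_I2) (simp only: space_haar_torus)
  moreover interpret pair_sigma_finite haar_torus haar_torus
    by (rule pair_sigma_finiteI[OF sT sT])
  have "{z\<in>space (haar_torus \<Otimes>\<^sub>M haar_torus). h' (fst z ** snd z) = h' (snd z)}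
      \<in> sets (haar_torus \<Otimes>\<^sub>M haar_torus)"
    by measurable
  ultimately have *: "AE t in haar_torus. AE a in haar_torus. h' (a ** t) = h' t"
    using AE_commute[of "\<lambda>a t. h' (a ** t) = h' t"] by blast
  have "AE t in haar_torus. AE s in haar_torus. h' s = h' t"
  proof (rule AE_mp[OF *], rule AE_I2, rule impI)
    fix t assume t: "t \<in> space haar_torus" and at: "AE a in haar_torus. h' (a ** t) = h' t"
    \<comment> \<open>\<open>t'\<close> is the inverse of \<open>t\<close>: writing the multiplier
      as the product of \<open>t'\<close> and s turns the invariance relation into the equality of
      \<open>h'\<close> at s and at \<open>t\<close>.\<close>
    define t' where "t' = diag2 (1 / t$1$1) (1 / (1 / t$1$1))"
    have t': "t' \<in> torus" using torus_pos[of t] t unfolding t'_def by (intro diag2_torus) simp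
    have A: "AE s in haar_torus. h' ((t' ** s) ** t) = h' t"
      by (rule nonsingular_AE[OF nonsingular_torus_mult[OF t'] at])
    have B: "(t' ** s) ** t = s" if "s \<in> torus" for s
      using torus_pos[of t] torus_pos[of s] t that
      by (auto simp: t'_def torus_def diag2_mult)
    show "AE s in haar_torus. h' s = h' t"
      using A AE_space[of haar_torus] by eventually_elim (simp add: B)
  qed
  then have "AE z in haar_torus \<Otimes>\<^sub>M haar_torus. h' (snd z) = h' (fst z)"
    by (intro AE_pairI[OF sT sT]) auto
  then have "AE x in tuples 2 haar_torus. h' (snd (x 0, x 1)) = h' (fst (x 0, x 1))"
    by (rule nonsingular_AE[rotated]) (auto intro!: nonsingular_two_components sT)
  then have "AE x in tuples 2 haar_torus. h' (x 1) = h' (x 0)"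
    by simp
  with fh show ?thesis
    by eventually_elim (simp add: hdiff_1[unfolded One_nat_def] h'_def)
qed

lemma AE_torus_ex:
  assumes "AE a in haar_torus. P a"
  shows "\<exists>a\<in>torus. P a"
proof (rule ccontr)
  assume "\<not> ?thesis"
  then have "AE a in haar_torus. P a \<longrightarrow> a \<notin> space haar_torus"
    by (intro AE_I2) auto
  then have "AE a in haar_torus. a \<notin> space haar_torus"
    using assms by eventually_elim simp
  then have "AE t in lborel. exp_torus t \<notin> space haar_torus"
    by (subst (asm) AE_torus_iff[OF sets.top])
  moreover have "exp_torus t \<in> space haar_torus" for t
    using diag2_torus[of "exp t"] by (simp add: exp_minus inverse_eq_divide)
  ultimately have "AE t in (lborel :: real measure). False"
    by simp
  then have "emeasure lborel (space (lborel :: real measure)) = 0"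
    using ae_filter_eq_bot_iff[of "lborel :: real measure"] by (simp add: trivial_limit_def)
  then show False by simp
qed

section \<open>Explicit representatives\<close>

text \<open>The torus component in the Iwasawa decomposition G = A N K with N lower unitriangular:
  the first row of a product of elements of N and K has norm 1, and an element of the torus scales
  it by its first entry.\<close>

definition torus_proj :: "real^2^2 \<Rightarrow> real^2^2" where
  "torus_proj g = diag2 (rnorm (Pt 0) g) (1 / rnorm (Pt 0) g)"

lemma equivariant_torus_proj: "equivariant_to_torus torus_proj"
  unfolding equivariant_to_torus_def
proof (intro conjI ballI)
  show m: "torus_proj \<in> measurable haar_SL2 haar_torus"
    unfolding torus_proj_def[abs_def] by (intro measurable_diag2) (auto simp: rnorm_pos)
  show eq: "torus_proj (a ** g) = a ** torus_proj g" if "a \<in> torus" for a g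
    using that by (auto simp: torus_proj_def torus_def rnorm_diag2 diag2_mult)
  text \<open>By equivariance, almost every translate of the preimage of a null set is null.\<close>
  have "A \<in> null_sets (distr haar_SL2 haar_torus torus_proj)" if A: "A \<in> null_sets haar_torus" for A
  proof -
    let ?P = "\<lambda>a g. a ** torus_proj g \<notin> A"
    note [measurable] = m
    have [measurable]: "A \<in> sets haar_torus" using A by auto
    interpret pair_sigma_finite haar_SL2 haar_torus
      by (rule pair_sigma_finiteI[OF sigma_finite_haar sigma_finite_torus])
    have "AE a in haar_torus. ?P a g" if "g \<in> SL2" for g
    proof -
      have g: "torus_proj g \<in> torus" using measurable_space[OF m] that by simp
      have "AE a in haar_torus. torus_proj g ** a \<notin> A"
        by (rule nonsingular_not_in[OF nonsingular_torus_mult[OF g] A])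
      moreover have "AE a in haar_torus. torus_proj g ** a = a ** torus_proj g"
        using torus_mult_commute[OF g] by (intro AE_I2) auto
      ultimately show ?thesis by eventually_elim simp
    qed
    then have "AE g in haar_SL2. AE a in haar_torus. ?P a g"
      by (rule AE_I2) (simp only: space_haar)
    moreover have "{z\<in>space (haar_SL2 \<Otimes>\<^sub>M haar_torus). ?P (snd z) (fst z)}
        \<in> sets (haar_SL2 \<Otimes>\<^sub>M haar_torus)"
      by measurable
    ultimately have "AE a in haar_torus. AE g in haar_SL2. ?P a g"
      using AE_commute[of "\<lambda>g a. ?P a g"] by blast
    then obtain a where a: "a \<in> torus" "AE g in haar_SL2. ?P a g"
      using AE_torus_ex by blast
    \<comment> \<open>\<open>a'\<close> is the inverse of \<open>a\<close>; translating by it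
      removes \<open>a\<close> from the statement about the good translate.\<close>
    define a' where "a' = diag2 (1 / a$1$1) (1 / (1 / a$1$1))"
    have a': "a' \<in> torus" using torus_pos[OF a(1)] unfolding a'_def by (intro diag2_torus) simp
    have "AE g in haar_SL2. ?P a (a' ** g)"
      by (rule nonsingular_AE[OF nonsingular_mult_left[OF torus_SL2[OF a']] a(2)])
    moreover have "a ** a' = mat 1"
      using a(1) by (auto simp: a'_def torus_def diag2_mult mat2_eq_iff mat_def matrix_mult_nth2)
    then have "a ** torus_proj (a' ** g) = torus_proj g" for g
      unfolding eq[OF a'] matrix_mul_assoc by (simp add: matrix_mul_lid)
    ultimately have "AE g in haar_SL2. torus_proj g \<notin> A" by simp
    moreover have "{x\<in>space haar_torus. x \<notin> A} \<in> sets haar_torus"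
      by measurable
    ultimately have "AE x in distr haar_SL2 haar_torus torus_proj. x \<notin> A"
      using AE_distr_iff[OF m, of "\<lambda>x. x \<notin> A"] by blast
    then show ?thesis by (subst AE_iff_null_sets) auto
  qed
  then show "absolutely_continuous haar_torus (distr haar_SL2 haar_torus torus_proj)"
    by (auto simp: absolutely_continuous_def)
qed

lemma bicomplexI_pointwise:
  assumes "f \<in> borel_measurable (bispace p q)"
    "\<And>k z. k \<in> SL2 \<Longrightarrow> z \<in> space (bispace p q) \<Longrightarrow> f (biact p q k z) = f z"
  shows "f \<in> bicomplex p q"
  using assms by (auto simp: bicomplex_def L0_inv_def intro!: AE_I2)

definition induced_cocycle ::
  "(real^2^2 \<Rightarrow> real) \<Rightarrow> (nat \<Rightarrow> real^2^2) \<times> (nat \<Rightarrow> P1 \<times> P1) \<Rightarrow> real" where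
  "induced_cocycle \<alpha> z = slope \<alpha> * (ln (rnorm (snd (snd z 0)) (fst z 1)) - ln (rnorm (snd (snd z 0)) (fst z 0)))"

lemma induced_cocycle_bicomplex: "induced_cocycle \<alpha> \<in> bicomplex 1 1"
proof (rule bicomplexI_pointwise)
  have [measurable]: "(\<lambda>z. snd (snd z 0)) \<in> measurable (bispace 1 1) P1_measure"
    by (rule measurable_compose[OF measurable_bispace_snd measurable_snd_pairs]) simp
  have [measurable]: "(\<lambda>z. fst z 0) \<in> measurable (bispace 1 1) haar_SL2"
    "(\<lambda>z. fst z 1) \<in> measurable (bispace 1 1) haar_SL2"
    by (rule measurable_bispace_fst, simp)+
  show "induced_cocycle \<alpha> \<in> borel_measurable (bispace 1 1)"
    unfolding induced_cocycle_def[abs_def] by measurable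
  fix k z assume k: "k \<in> SL2" and z: "z \<in> space (bispace 1 1)"
  obtain l where l: "\<And>x. l x \<noteq> 0" "\<And>x h. rnorm (mobius k x) (k ** h) = \<bar>l x\<bar> * rnorm x h"
    using bracket_rnorm_mobius[OF k] by metis
  have "fst z 0 \<in> SL2" "fst z 1 \<in> SL2" using bispace_SL2[OF z] by auto
  then show "induced_cocycle \<alpha> (biact 1 1 k z) = induced_cocycle \<alpha> z"
    using l rnorm_pos[of "fst z 0" "snd (snd z 0)"] rnorm_pos[of "fst z 1" "snd (snd z 0)"]
    by (simp add: induced_cocycle_def biact_nth[unfolded One_nat_def] mobius_pair_def ln_mult)
qed

text \<open>This makes \<open>induced_cocycle\<close> the Eckmann-Shapiro image of the torus cocycle
  pulled back along \<open>torus_proj\<close>: the first entry of that retraction is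
  \<open>rnorm (Pt 0)\<close>, and the factor from \<open>rnorm_coset\<close> cancels in the
  difference.\<close>

lemma induced_cocycle_coset:
  assumes "h \<in> SL2" "z 0 \<in> SL2" "z 1 \<in> SL2"
  shows "induced_cocycle \<alpha> (z, tuple1 (coset_pair h)) =
    slope \<alpha> * (ln (rnorm (Pt 0) (adj2 h ** z 1)) - ln (rnorm (Pt 0) (adj2 h ** z 0)))"
proof -
  obtain l where l: "l \<noteq> 0" "\<And>g. rnorm (snd (coset_pair h)) g = \<bar>l\<bar> * rnorm (Pt 0) (adj2 h ** g)"
    using rnorm_coset[OF assms(1)] by metis
  have "0 < rnorm (Pt 0) (adj2 h ** z 1)" "0 < rnorm (Pt 0) (adj2 h ** z 0)"
    using assms by (auto intro!: rnorm_pos SL2_mult adj2_SL2)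
  then show ?thesis
    using l by (simp add: induced_cocycle_def ln_mult)
qed

lemma d_up_induced_cocycle: "d_up 1 (induced_cocycle \<alpha>) z = 0"
proof -
  have "d_up 1 (induced_cocycle \<alpha>) z = hdiff 2 (\<lambda>g. induced_cocycle \<alpha> (g, snd z)) (fst z)"
    by (simp add: d_up_def numeral_2_eq_2)
  then show ?thesis
    by (simp add: hdiff_2 induced_cocycle_def algebra_simps)
qed

lemma represents_induced_cocycle:
  assumes \<alpha>: "\<alpha> \<in> lie_torus_dual"
  shows "represents (induced_cocycle \<alpha>) (torus_cocycle \<alpha>)"
proof -
  define p where "p g = (\<lambda>i\<in>{..<2::nat}. torus_proj (g i))" for g
  have p: "p g 0 = torus_proj (g 0)" "p g (Suc 0) = torus_proj (g (Suc 0))" for g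
    by (simp_all add: p_def)
  have m: "torus_proj \<in> measurable haar_SL2 haar_torus"
    and eq: "\<And>a g. a \<in> torus \<Longrightarrow> g \<in> SL2 \<Longrightarrow> torus_proj (a ** g) = a ** torus_proj g"
    using equivariant_torus_proj by (auto simp: equivariant_to_torus_def)
  have T: "torus_proj g \<in> torus" if "g \<in> SL2" for g
    using measurable_space[OF m] that by simp
  have cochain: "(\<lambda>g. torus_cocycle \<alpha> (p g)) \<in> cochains torus (**) haar_SL2 1"
  proof (rule cochainsI_pointwise)
    show "(\<lambda>g. torus_cocycle \<alpha> (p g)) \<in> borel_measurable (tuples (Suc 1) haar_SL2)"
      by (rule torus_cocycle_measurable[OF \<alpha> _ _ p])
         (rule measurable_compose[OF measurable_tuples_nth m], simp)+
    fix a x assume a: "a \<in> torus" and "x \<in> space (tuples (Suc 1) haar_SL2)"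
    then have x: "x 0 \<in> SL2" "x 1 \<in> SL2" by (auto simp: space_PiM PiE_iff)
    have "p (diag_act (Suc 1) (**) a x) = diag_act (Suc 1) (**) a (p x)"
      using eq[OF a] x by (auto simp: p_def diag_act_def fun_eq_iff less_Suc_eq)
    then show "torus_cocycle \<alpha> (p (diag_act (Suc 1) (**) a x)) = torus_cocycle \<alpha> (p x)"
      using torus_cocycle_invariant[OF \<alpha> a, of "p x"] x T p by simp
  qed
  have "eckmann_shapiro 1 (\<lambda>g. torus_cocycle \<alpha> (p g)) (induced_cocycle \<alpha>)"
    unfolding eckmann_shapiro_def
  proof (intro conjI cochain induced_cocycle_bicomplex AE_I2)
    fix z assume "z \<in> space (haar_SL2 \<Otimes>\<^sub>M tuples (Suc 1) haar_SL2)"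
    then have z1: "fst z \<in> SL2" and zs: "snd z \<in> space (tuples (Suc 1) haar_SL2)"
      unfolding space_pair_measure space_haar mem_Times_iff by blast+
    have z: "fst z \<in> SL2" "snd z 0 \<in> SL2" "snd z 1 \<in> SL2"
      using z1 tuples_nth_space[OF zs, of 0] tuples_nth_space[OF zs, of 1] by simp_all
    let ?k = "adj2 (fst z)"
    have k: "?k ** snd z 0 \<in> SL2" "?k ** snd z 1 \<in> SL2"
      using z by (auto intro!: SL2_mult adj2_SL2)
    have "torus_cocycle \<alpha> (p (diag_act (Suc 1) (**) ?k (snd z))) =
        slope \<alpha> * (ln (torus_proj (?k ** snd z 1) $1$1) - ln (torus_proj (?k ** snd z 0) $1$1))"
      using torus_cocycle_eq[OF \<alpha>, of "p (diag_act (Suc 1) (**) ?k (snd z))"] T[OF k(1)] T[OF k(2)]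
      by (simp add: p diag_act_def)
    then show "induced_cocycle \<alpha> (snd z, \<lambda>j\<in>{..<1}. coset_pair (fst z)) =
        torus_cocycle \<alpha> (p (diag_act (Suc 1) (**) (matrix_inv (fst z)) (snd z)))"
      using induced_cocycle_coset[OF z(1), of "snd z" \<alpha>] z
      by (simp add: matrix_inv_SL2 torus_proj_def tuple1_def)
  qed
  moreover have "(\<lambda>z. 0) \<in> bicomplex 0 1"
    by (simp add: bicomplex_def L0_inv_zero)
  moreover have "AE z in bispace 1 1. induced_cocycle \<alpha> z = induced_cocycle \<alpha> z + d_up 0 (\<lambda>z. 0) z"
    by (simp add: d_up_0)
  ultimately show ?thesis
    unfolding represents_def
    using torus_cocycle_in_cocycles[OF \<alpha>] induced_cocycle_bicomplex[of \<alpha>] d_up_induced_cocycle[of \<alpha>]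
      equivariant_torus_proj
    unfolding p_def by (intro conjI exI[of _ torus_proj] exI[of _ "induced_cocycle \<alpha>"] exI[of _ "\<lambda>z. 0"]) auto
qed

text \<open>One logarithm of a quotient instead of four logarithms: the argument is invariant even
  where a bracket vanishes, so that invariance holds pointwise. The logarithm is split only on
  generic tuples.\<close>

definition primitive ::
  "(real^2^2 \<Rightarrow> real) \<Rightarrow> (nat \<Rightarrow> real^2^2) \<times> (nat \<Rightarrow> P1 \<times> P1) \<Rightarrow> real" where
  "primitive \<alpha> z = slope \<alpha> *
     ln (rnorm (snd (snd z 1)) (fst z 0) * \<bar>bracket (snd (snd z 0)) (fst (snd z 1))\<bar> /
        (rnorm (snd (snd z 0)) (fst z 0) * \<bar>bracket (fst (snd z 1)) (snd (snd z 1))\<bar>))"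

lemma primitive_bicomplex: "primitive \<alpha> \<in> bicomplex 0 2"
proof (rule bicomplexI_pointwise)
  have [measurable]: "(\<lambda>z. snd (snd z 0)) \<in> measurable (bispace 0 2) P1_measure"
    "(\<lambda>z. snd (snd z 1)) \<in> measurable (bispace 0 2) P1_measure"
    "(\<lambda>z. fst (snd z 1)) \<in> measurable (bispace 0 2) P1_measure"
    by (rule measurable_compose[OF measurable_bispace_snd measurable_snd_pairs]
          measurable_compose[OF measurable_bispace_snd measurable_fst_pairs], simp)+
  have [measurable]: "(\<lambda>z. fst z 0) \<in> measurable (bispace 0 2) haar_SL2"
    by (rule measurable_bispace_fst, simp)+
  show "primitive \<alpha> \<in> borel_measurable (bispace 0 2)"
    unfolding primitive_def[abs_def] by measurable
  fix k z assume k: "k \<in> SL2" and z: "z \<in> space (bispace 0 2)"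
  obtain l where l: "\<And>x. l x \<noteq> 0" "\<And>x y. bracket (mobius k x) (mobius k y) = l x * l y * bracket x y"
    "\<And>x h. rnorm (mobius k x) (k ** h) = \<bar>l x\<bar> * rnorm x h"
    using bracket_rnorm_mobius[OF k] by metis
  \<comment> \<open>Here \<open>a\<close>, \<open>b\<close> and \<open>c\<close> stand for the
    scaling factors of y_2, x_2 and y_1.\<close>
  have "(\<bar>a\<bar> * r * \<bar>b * c * s\<bar>) / (\<bar>b\<bar> * r' * \<bar>c * a * s'\<bar>) = r * \<bar>s\<bar> / (r' * \<bar>s'\<bar>)"
    if "a \<noteq> 0" "b \<noteq> 0" "c \<noteq> 0" for a b c r r' s s' :: real
    using that by (simp add: abs_mult)
  then show "primitive \<alpha> (biact 0 2 k z) = primitive \<alpha> z"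
    unfolding primitive_def using l
    by (simp add: biact_nth mobius_pair_def)
qed

lemma primitive_generic:
  assumes "generic 2 (snd z)" "fst z 0 \<in> SL2"
  shows "primitive \<alpha> z = slope \<alpha> *
    (ln (rnorm (snd (snd z 1)) (fst z 0)) - ln (rnorm (snd (snd z 0)) (fst z 0)) +
     ln \<bar>bracket (snd (snd z 0)) (fst (snd z 1))\<bar> - ln \<bar>bracket (fst (snd z 1)) (snd (snd z 1))\<bar>)"
proof -
  have "0 < rnorm (snd (snd z 1)) (fst z 0)" "0 < rnorm (snd (snd z 0)) (fst z 0)"
    using rnorm_pos[OF assms(2)] by auto
  moreover have "snd (snd z 0) \<noteq> fst (snd z 1)" "snd (snd z 1) \<noteq> fst (snd z 1)"
    using assms(1) by (auto simp: generic_def)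
  then have "bracket (snd (snd z 0)) (fst (snd z 1)) \<noteq> 0" "bracket (fst (snd z 1)) (snd (snd z 1)) \<noteq> 0"
    unfolding bracket_eq_0_iff by metis+
  ultimately show ?thesis
    by (simp add: primitive_def ln_mult ln_div)
qed

lemma d_up_primitive: "AE z in bispace 1 2. d_up 0 (primitive \<alpha>) z = d_right 1 1 (induced_cocycle \<alpha>) z"
  using AE_bispace_generic AE_space
proof eventually_elim
  case (elim z)
  have "fst z 0 \<in> SL2" "fst z 1 \<in> SL2" using bispace_SL2[OF elim(2)] by auto
  then show ?case
    unfolding d_up_0 d_right_11
    using elim(1) by (simp add: primitive_generic induced_cocycle_def algebra_simps)
qed

definition cross_ratio_cocycle :: "(real^2^2 \<Rightarrow> real) \<Rightarrow> (nat \<Rightarrow> P1 \<times> P1) \<Rightarrow> real" where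
  "cross_ratio_cocycle \<alpha> w =
     - slope \<alpha> * ln \<bar>cross_ratio (snd (w 0)) (fst (w 1)) (snd (w 1)) (fst (w 2)) - 1\<bar>"

text \<open>The factor -2 built into \<open>lie_of_real\<close> turns 1/2 into the coefficient -1,
  which is the sign carried by \<open>d_right 0 2\<close>.\<close>

lemma cross_ratio_cocycle_eq:
  assumes "\<alpha> \<in> lie_torus_dual"
  shows "1 / 2 * \<alpha> (lie_of_real (ln
     \<bar>cross_ratio (snd (w 0)) (fst (w 1)) (snd (w 1)) (fst (w 2)) - 1\<bar>)) = cross_ratio_cocycle \<alpha> w"
proof -
  have "\<alpha> (lie_of_real t) = slope \<alpha> * (- 2 * t)" for t
    using alpha_diag2[OF assms, of "- 2 * t"] by (simp add: lie_of_real_def)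
  then show ?thesis by (simp add: cross_ratio_cocycle_def)
qed

text \<open>The three-term Pluecker relation between the brackets of four vectors in the plane; the
  assumptions keep both factors of the denominator away from 0.\<close>

lemma cross_ratio_minus_1:
  assumes "a \<noteq> d" "b \<noteq> c"
  shows "cross_ratio a b c d - 1 = bracket a b * bracket d c / (bracket a d * bracket c b)"
proof -
  have "bracket a d \<noteq> 0" "bracket c b \<noteq> 0"
    using assms unfolding bracket_eq_0_iff by auto
  moreover have "bracket a c * bracket d b - bracket a d * bracket c b = bracket a b * bracket d c"
    unfolding bracket_def by algebra
  ultimately show ?thesis
    by (simp add: cross_ratio_def field_simps)
qed

lemma cross_ratio_cocycle_generic:
  assumes "snd (w 0) \<noteq> fst (w 1)" "snd (w 0) \<noteq> fst (w 2)" "fst (w 1) \<noteq> snd (w 1)" "snd (w 1) \<noteq> fst (w 2)"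
  shows "cross_ratio_cocycle \<alpha> w = - slope \<alpha> *
    (ln \<bar>bracket (snd (w 0)) (fst (w 1))\<bar> + ln \<bar>bracket (snd (w 1)) (fst (w 2))\<bar> -
     ln \<bar>bracket (snd (w 0)) (fst (w 2))\<bar> - ln \<bar>bracket (fst (w 1)) (snd (w 1))\<bar>)"
proof -
  have sym: "\<bar>bracket x y\<bar> = \<bar>bracket y x\<bar>" for x y
  proof -
    have "bracket x y = - bracket y x" unfolding bracket_def by algebra
    then show ?thesis by simp
  qed
  have "bracket (snd (w 0)) (fst (w 1)) \<noteq> 0" "bracket (snd (w 0)) (fst (w 2)) \<noteq> 0"
    "bracket (fst (w 1)) (snd (w 1)) \<noteq> 0" "bracket (snd (w 1)) (fst (w 2)) \<noteq> 0"
    using assms unfolding bracket_eq_0_iff by auto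
  then show ?thesis
    unfolding cross_ratio_cocycle_def cross_ratio_minus_1[OF assms(2,3)] abs_mult abs_divide
      sym[of "fst (w 2)" "snd (w 1)"] sym[of "snd (w 1)" "fst (w 1)"]
    by (simp add: ln_mult ln_div)
qed

text \<open>In the alternating sum each norm occurs twice with opposite signs, and so does the
  bracket of z_1 and z_2. The four remaining logarithms are those of the cross ratio minus
  1.\<close>

lemma d_right_primitive: "AE z in bispace 0 3. d_right 0 2 (primitive \<alpha>) z = cross_ratio_cocycle \<alpha> (snd z)"
  using AE_bispace_generic AE_space
proof eventually_elim
  case (elim z)
  have g: "fst z 0 \<in> SL2" using bispace_SL2[OF elim(2)] by auto
  have gen: "generic 2 (tuple2 (snd z i) (snd z j))" if "i < j" "j < 3" for i j
    using elim(1) that unfolding generic_def by (auto simp: less_2_iff)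
  have "cross_ratio_cocycle \<alpha> (snd z) = - slope \<alpha> *
    (ln \<bar>bracket (snd (snd z 0)) (fst (snd z 1))\<bar> + ln \<bar>bracket (snd (snd z 1)) (fst (snd z 2))\<bar> -
     ln \<bar>bracket (snd (snd z 0)) (fst (snd z 2))\<bar> - ln \<bar>bracket (fst (snd z 1)) (snd (snd z 1))\<bar>)"
    using elim(1) unfolding generic_def by (intro cross_ratio_cocycle_generic) (metis less_numeral_extra numeral_3_eq_3 lessI less_SucI One_nat_def numeral_2_eq_2)+
  then show ?case
    unfolding d_right_02 hdiff_2
    by (simp add: primitive_generic g gen algebra_simps)
qed

lemma cross_ratio_cocycle_in_cocycles: "cross_ratio_cocycle \<alpha> \<in> cocycles SL2 mobius_pair pairs 2"
proof -
  have "cross_ratio_cocycle \<alpha> \<in> cochains SL2 mobius_pair pairs 2"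
  proof (rule cochainsI_pointwise)
    have [measurable]: "(\<lambda>w. snd (w 0)) \<in> measurable (tuples (Suc 2) pairs) P1_measure"
      "(\<lambda>w. fst (w 1)) \<in> measurable (tuples (Suc 2) pairs) P1_measure"
      "(\<lambda>w. snd (w 1)) \<in> measurable (tuples (Suc 2) pairs) P1_measure"
      "(\<lambda>w. fst (w 2)) \<in> measurable (tuples (Suc 2) pairs) P1_measure"
      by (rule measurable_compose[OF measurable_tuples_nth measurable_snd_pairs]
            measurable_compose[OF measurable_tuples_nth measurable_fst_pairs], simp)+
    show "cross_ratio_cocycle \<alpha> \<in> borel_measurable (tuples (Suc 2) pairs)"
      unfolding cross_ratio_cocycle_def[abs_def] by measurable
    show "cross_ratio_cocycle \<alpha> (diag_act (Suc 2) mobius_pair k w) = cross_ratio_cocycle \<alpha> w" if "k \<in> SL2" for k w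
      by (simp add: cross_ratio_cocycle_def diag_act_def mobius_pair_def cross_ratio_mobius[OF that])
  qed
  moreover have "AE w in tuples 4 pairs. hdiff 3 (cross_ratio_cocycle \<alpha>) w = 0"
    using AE_generic
  proof eventually_elim
    case (elim w)
    have gen: "snd (w i) \<noteq> fst (w j)" if "i < 4" "j < 4" for i j
      using elim that by (auto simp: generic_def)
    \<comment> \<open>Up to the coefficient, \<open>E i j k\<close> is b(j,k) - b(i,k) + b(i,j),
      where b(i,j) is the logarithm for \<open>snd (w i)\<close> and \<open>fst (w j)\<close> minus
      the one for the two points of \<open>w j\<close>. The cocycle identity is thus formal; b
      itself is not invariant, so it is no primitive in the complex.\<close>
    define E where "E i j k = - slope \<alpha> *
      (ln \<bar>bracket (snd (w i)) (fst (w j))\<bar> + ln \<bar>bracket (snd (w j)) (fst (w k))\<bar> -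
       ln \<bar>bracket (snd (w i)) (fst (w k))\<bar> - ln \<bar>bracket (fst (w j)) (snd (w j))\<bar>)" for i j k
    have *: "cross_ratio_cocycle \<alpha> (face 3 n w) = E i j k"
      if "face 3 n w 0 = w i" "face 3 n w 1 = w j" "face 3 n w 2 = w k" "i < 4" "j < 4" "k < 4"
      for n i j k
      unfolding E_def
      using cross_ratio_cocycle_generic[of "face 3 n w" \<alpha>] gen[of i j] gen[of i k] gen[of j j] gen[of j k] that
      by (metis (no_types, lifting))
    have "cross_ratio_cocycle \<alpha> (face 3 0 w) = E 1 2 3" "cross_ratio_cocycle \<alpha> (face 3 1 w) = E 0 2 3"
      "cross_ratio_cocycle \<alpha> (face 3 2 w) = E 0 1 3" "cross_ratio_cocycle \<alpha> (face 3 3 w) = E 0 1 2"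
      by (rule *; simp add: face_def eval_nat_numeral)+
    then show ?case unfolding hdiff_3 by (simp add: E_def algebra_simps)
  qed
  moreover have eq: "Suc 2 = (3::nat)" "Suc 3 = (4::nat)" by simp_all
  ultimately show ?thesis
    unfolding cocycles_def mem_Collect_eq eq by blast
qed

section \<open>Independence of choices\<close>

abbreviation neg_one :: "real^2^2" where
  "neg_one \<equiv> diag2 (- 1) (- 1)"

lemma adj2_mult:
  fixes g h :: "real^2^2"
  shows "adj2 (g ** h) = adj2 h ** adj2 g"
  by (simp add: mat2_eq_iff matrix_mult_nth2)

lemma adj2_diag2: "t \<noteq> 0 \<Longrightarrow> adj2 (diag2 t (1 / t)) = diag2 (1 / t) (1 / (1 / t))"
  by (simp add: mat2_eq_iff)

lemma diag2_SL2: "t \<noteq> 0 \<Longrightarrow> diag2 t (1 / t) \<in> SL2"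
  by (simp add: SL2_iff)

lemma coset_pair_mult: "k \<in> SL2 \<Longrightarrow> h \<in> SL2 \<Longrightarrow> coset_pair (k ** h) = mobius_pair k (coset_pair h)"
  by (simp add: coset_pair_def mobius_pair_mult)

lemma coset_pair_diag2:
  assumes "h \<in> SL2" "t \<noteq> 0"
  shows "coset_pair (h ** diag2 t (1 / t)) = coset_pair h"
  using assms by (simp add: coset_pair_mult diag2_SL2) (simp add: coset_pair_def mobius_pair_def)

lemma coset_pair_neq:
  assumes "h \<in> SL2"
  shows "fst (coset_pair h) \<noteq> snd (coset_pair h)"
proof
  assume "fst (coset_pair h) = snd (coset_pair h)"
  then have "mobius (adj2 h) (mobius h Infty) = mobius (adj2 h) (mobius h (Pt 0))"
    by (simp add: coset_pair_def mobius_pair_def)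
  then show False by (simp add: mobius_adj2[OF assms] del: mobius.simps)
qed

text \<open>A function on \<open>G\<close> invariant under the full diagonal subgroup, that is under the stabiliser
  of the base point \<open>(\<infinity>, 0)\<close> rather than only under the torus, induces a function on
  \<open>G \<times> G/A\<close>.\<close>

definition induce0 ::
  "(real^2^2 \<Rightarrow> real) \<Rightarrow> (nat \<Rightarrow> real^2^2) \<times> (nat \<Rightarrow> P1 \<times> P1) \<Rightarrow> real" where
  "induce0 \<delta> z = \<delta> (adj2 (frame (snd z 0)) ** fst z 0)"

text \<open>Any \<open>h\<close> over the same pair may replace the frame: the two differ by a
  diagonal matrix on the right, whose inverse appears on the left of the argument and is absorbed by
  the invariance of \<open>\<delta>\<close>.\<close>

lemma induce0_coset:
  assumes inv: "\<And>t g. t \<noteq> 0 \<Longrightarrow> g \<in> SL2 \<Longrightarrow> \<delta> (diag2 t (1 / t) ** g) = \<delta> g"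
    and h: "h \<in> SL2" "coset_pair h = snd z 0" and g: "fst z 0 \<in> SL2"
  shows "induce0 \<delta> z = \<delta> (adj2 h ** fst z 0)"
proof -
  have "coset_pair (frame (snd z 0)) = coset_pair h"
    using coset_pair_frame coset_pair_neq[OF h(1)] h(2) by metis
  then obtain t where t: "t \<noteq> 0" "h = frame (snd z 0) ** diag2 t (1 / t)"
    using coset_pair_eqE[OF frame_SL2 h(1)] by metis
  have "adj2 h ** fst z 0 = diag2 (1 / t) (1 / (1 / t)) ** (adj2 (frame (snd z 0)) ** fst z 0)"
    unfolding t(2) adj2_mult adj2_diag2[OF t(1)] by (simp add: matrix_mul_assoc)
  moreover have "adj2 (frame (snd z 0)) ** fst z 0 \<in> SL2"
    using g by (intro SL2_mult adj2_SL2 frame_SL2)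
  ultimately show ?thesis
    using inv[of "1 / t"] t(1) by (simp add: induce0_def)
qed

lemma induce0_bicomplex:
  assumes inv: "\<And>t g. t \<noteq> 0 \<Longrightarrow> g \<in> SL2 \<Longrightarrow> \<delta> (diag2 t (1 / t) ** g) = \<delta> g"
    and m: "\<delta> \<in> borel_measurable haar_SL2"
  shows "induce0 \<delta> \<in> bicomplex 0 1"
proof -
  have mx: "(\<lambda>z. snd z 0) \<in> measurable (bispace 0 1) pairs"
    and [measurable]: "(\<lambda>z. fst z 0) \<in> measurable (bispace 0 1) haar_SL2"
    by (rule measurable_bispace_snd measurable_bispace_fst; simp)+
  have [measurable]: "(\<lambda>z. adj2 (frame (snd z 0))) \<in> measurable (bispace 0 1) haar_SL2"
    by (rule measurable_compose[OF measurable_compose[OF mx measurable_frame] measurable_adj2])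
  have "(\<lambda>z. adj2 (frame (snd z 0)) ** fst z 0) \<in> measurable (bispace 0 1) haar_SL2"
    by measurable
  then have "induce0 \<delta> \<in> borel_measurable (bispace 0 1)"
    unfolding induce0_def[abs_def] by (rule measurable_compose) (rule m)
  moreover have "AE z in bispace 0 1. induce0 \<delta> (biact 0 1 k z) = induce0 \<delta> z" if k: "k \<in> SL2" for k
    using AE_bispace_generic AE_space
  proof eventually_elim
    case (elim z)
    have "fst (snd z 0) \<noteq> snd (snd z 0)"
      using elim(1) by (auto simp: generic_def)
    then have c: "coset_pair (frame (snd z 0)) = snd z 0" by (rule coset_pair_frame)
    have g: "fst z 0 \<in> SL2" using bispace_SL2[OF elim(2)] by simp
    \<comment> \<open>\<open>k ** frame (snd z 0)\<close> lies over the translated pair; it need not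
      be the frame of that pair. With this choice \<open>k\<close> cancels.\<close>
    have "induce0 \<delta> (biact 0 1 k z) = \<delta> (adj2 (k ** frame (snd z 0)) ** (k ** fst z 0))"
      using induce0_coset[OF inv, of "k ** frame (snd z 0)" "biact 0 1 k z"]
      by (simp add: biact_nth[unfolded One_nat_def] SL2_mult k frame_SL2 coset_pair_mult c g)
    also have "adj2 (k ** frame (snd z 0)) ** (k ** fst z 0) = adj2 (frame (snd z 0)) ** fst z 0"
      unfolding adj2_mult matrix_mul_assoc[symmetric] adj2_cancel[OF k] ..
    finally show ?case by (simp add: induce0_def)
  qed
  ultimately show ?thesis unfolding bicomplex_def L0_inv_def by blast
qed

text \<open>Version of \<open>AE_pairs_from_coset\<close> with the group variables as parameters,
  fixed by Fubini. It is needed because \<open>eckmann_shapiro\<close> describes the induced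
  function only at pairs written as \<open>coset_pair h\<close>, for almost every h.\<close>

lemma AE_bispace_from_coset:
  assumes meas: "{z\<in>space (bispace p 1). P z} \<in> sets (bispace p 1)"
    and ae: "AE z in haar_SL2 \<Otimes>\<^sub>M tuples (Suc p) haar_SL2. P (snd z, tuple1 (coset_pair (fst z)))"
  shows "AE z in bispace p 1. P z"
proof -
  note sf = sigma_finite_tuples sigma_finite_haar sigma_finite_pairs
  have P: "Measurable.pred (tuples (Suc p) haar_SL2 \<Otimes>\<^sub>M tuples 1 pairs) P"
    using meas unfolding bispace_def pred_def .
  have "AE z in tuples (Suc p) haar_SL2 \<Otimes>\<^sub>M haar_SL2. P (fst z, tuple1 (coset_pair (snd z)))"
    using nonsingular_AE[OF nonsingular_swap[OF sf(1,4)] ae] by simp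
  then have *: "AE g in tuples (Suc p) haar_SL2. AE h in haar_SL2. P (g, tuple1 (coset_pair h))"
    using AE_pairD[OF sf(1,4)] by fastforce
  show ?thesis
    unfolding bispace_def
  proof (rule AE_pairI[OF sf(1,2) meas[unfolded bispace_def]])
    show "AE g in tuples (Suc p) haar_SL2. AE y in tuples 1 pairs. P (g, y)"
    proof (rule AE_mp[OF *], rule AE_I2, rule impI)
      fix g assume g: "g \<in> space (tuples (Suc p) haar_SL2)"
        and h: "AE h in haar_SL2. P (g, tuple1 (coset_pair h))"
      have "(\<lambda>x. (g, tuple1 x)) \<in> measurable pairs (tuples (Suc p) haar_SL2 \<Otimes>\<^sub>M tuples 1 pairs)"
        using g by (intro measurable_Pair measurable_const
            nonsingular_measurable[OF nonsingular_tuple1[OF sf(5)]])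
      then have "Measurable.pred pairs (\<lambda>x. P (g, tuple1 x))"
        by (rule measurable_compose[OF _ P])
      then have "AE x in pairs. P (g, tuple1 x)"
        using h unfolding pred_def by (rule AE_pairs_from_coset)
      then have "AE y in tuples 1 pairs. P (g, tuple1 (y 0))"
        by (rule nonsingular_AE[rotated]) (auto intro!: nonsingular_component sf)
      then show "AE y in tuples 1 pairs. P (g, y)"
        using AE_space[of "tuples 1 pairs"] by eventually_elim (simp only: tuple1_nth_space)
    qed
  qed
qed

text \<open>Both \<open>h\<close> and \<open>-h\<close> lie over the same pair, so that the invariance of the difference of two
  inductions under the diagonal subgroup is enforced by averaging over \<open>{1, -1}\<close>.\<close>

lemma represents_unique:
  assumes \<alpha>: "\<alpha> \<in> lie_torus_dual"
    and f: "f \<in> cohom_class torus (**) haar_torus 1 (torus_cocycle \<alpha>)"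
    and a: "represents a f"
  obtains e where "e \<in> bicomplex 0 1"
    "AE z in bispace 1 1. a z = induced_cocycle \<alpha> z + d_up 0 e z"
proof -
  note sf = sigma_finite_tuples sigma_finite_haar sigma_finite_pairs sigma_finite_torus
  obtain r F b where r: "equivariant_to_torus r"
    and F: "eckmann_shapiro 1 (\<lambda>g. f (\<lambda>i\<in>{..<2}. r (g i))) F"
    and b: "b \<in> bicomplex 0 1" "AE z in bispace 1 1. a z = F z + d_up 0 b z"
    using a unfolding represents_def by blast
  have rm: "r \<in> measurable haar_SL2 haar_torus"
    and eq: "\<And>a g. a \<in> torus \<Longrightarrow> g \<in> SL2 \<Longrightarrow> r (a ** g) = a ** r g"
    using r by (auto simp: equivariant_to_torus_def)
  have rT: "r g \<in> torus" if "g \<in> SL2" for g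
    using measurable_space[OF rm] that by simp
  have rns: "nonsingular haar_SL2 haar_torus r"
  proof (rule nonsingularI[OF rm])
    fix A assume A: "A \<in> null_sets haar_torus"
    then have "A \<in> null_sets (distr haar_SL2 haar_torus r)"
      using r by (auto simp: equivariant_to_torus_def absolutely_continuous_def)
    then show "AE g in haar_SL2. r g \<notin> A"
      by (rule AE_distrD[OF rm AE_not_in])
  qed
  let ?H2 = "tuples (Suc 1) haar_SL2"
  let ?M = "haar_SL2 \<Otimes>\<^sub>M ?H2"
  \<comment> \<open>The logarithm of the ratio of the given retraction \<open>r\<close> to
    \<open>torus_proj\<close>, times the slope. Equivariance of both makes it invariant under the
    torus, but nothing relates the values of \<open>r\<close> at g and at -g.\<close>
  define \<delta> where "\<delta> g = slope \<alpha> * (ln (r g $1$1) - ln (rnorm (Pt 0) g))" for g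
  define \<delta>' where "\<delta>' g = (\<delta> g + \<delta> (neg_one ** g)) / 2" for g
  have \<delta>_inv: "\<delta> (c ** g) = \<delta> g" if "c \<in> torus" "g \<in> SL2" for c g
  proof -
    have "0 < r g $1$1" "0 < c$1$1" "0 < rnorm (Pt 0) g"
      using torus_pos[OF rT] torus_pos rnorm_pos that by auto
    moreover have "rnorm (Pt 0) (c ** g) = c$1$1 * rnorm (Pt 0) g"
      using that(1) by (auto simp: torus_def rnorm_diag2)
    ultimately show ?thesis
      using that by (simp add: \<delta>_def eq torus_mult_nth ln_mult)
  qed
  have neg: "neg_one \<in> SL2" using diag2_SL2[of "- 1"] by simp
  have neg_neg: "neg_one ** (neg_one ** g) = g" for g :: "real^2^2"
    by (simp add: mat2_eq_iff matrix_mult_nth2)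
  have neg_comm: "neg_one ** (c ** g) = c ** (neg_one ** g)" for c g :: "real^2^2"
    by (simp add: mat2_eq_iff matrix_mult_nth2)
  have \<delta>'_torus: "\<delta>' (c ** g) = \<delta>' g" if "c \<in> torus" "g \<in> SL2" for c g
    using \<delta>_inv[OF that] \<delta>_inv[OF that(1), of "neg_one ** g"] that neg
    by (simp add: \<delta>'_def neg_comm SL2_mult)
  have \<delta>'_inv: "\<delta>' (diag2 t (1 / t) ** g) = \<delta>' g" if "t \<noteq> 0" "g \<in> SL2" for t g
  proof (cases "0 < t")
    case True
    then show ?thesis using \<delta>'_torus[OF diag2_torus that(2)] by simp
  next
    case False
    with that have t: "0 < - t" by simp
    have "diag2 t (1 / t) ** g = neg_one ** (diag2 (- t) (1 / (- t)) ** g)"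
      by (simp add: mat2_eq_iff matrix_mult_nth2)
    moreover have "\<delta>' (neg_one ** h) = \<delta>' h" for h
      unfolding \<delta>'_def neg_neg by simp
    ultimately show ?thesis using \<delta>'_torus[OF diag2_torus[OF t] that(2)] by simp
  qed
  have \<delta>m: "\<delta> \<in> borel_measurable haar_SL2"
  proof -
    note [measurable] = rm
    show ?thesis unfolding \<delta>_def[abs_def] by measurable
  qed
  have \<delta>'m: "\<delta>' \<in> borel_measurable haar_SL2"
  proof -
    have "(\<lambda>g. \<delta> (neg_one ** g)) \<in> borel_measurable haar_SL2"
      by (rule measurable_compose[OF nonsingular_measurable[OF nonsingular_mult_left[OF neg]] \<delta>m])
    then show ?thesis using \<delta>m unfolding \<delta>'_def[abs_def] by measurable
  qed
  define b' where "b' = induce0 \<delta>'"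
  have b': "b' \<in> bicomplex 0 1"
    unfolding b'_def by (rule induce0_bicomplex[OF \<delta>'_inv \<delta>'m])
  let ?G = "\<lambda>z. induced_cocycle \<alpha> (snd z, tuple1 (coset_pair (fst z)))"
  let ?F = "\<lambda>z. F (snd z, tuple1 (coset_pair (fst z)))"
  have spM: "fst z \<in> SL2 \<and> snd z 0 \<in> SL2 \<and> snd z 1 \<in> SL2" if "z \<in> space ?M" for z
  proof -
    have "fst z \<in> SL2" "snd z \<in> space ?H2"
      using that unfolding space_pair_measure space_haar mem_Times_iff by blast+
    then show ?thesis using tuples_nth_space[of "snd z" "Suc 1" haar_SL2 0]
      tuples_nth_space[of "snd z" "Suc 1" haar_SL2 1] by simp
  qed
  let ?p = "\<lambda>z. \<lambda>i\<in>{..<2::nat}. r (adj2 (fst z) ** snd z i)"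
  \<comment> \<open>\<open>f\<close> agrees with the torus cocycle only almost everywhere on pairs
    from the torus, so the equality can be pulled back only along a nonsingular map. Once h is
    fixed, translation by its inverse followed by \<open>r\<close> acts on each group variable
    separately.\<close>
  have "nonsingular ?M (tuples 2 haar_torus) ?p"
  proof (rule nonsingular_sections[OF sf(4,1)])
    show "?p \<in> measurable ?M (tuples 2 haar_torus)"
    proof (rule measurable_restrict)
      fix i :: nat assume i: "i \<in> {..<2}"
      have "(\<lambda>z. snd z i) \<in> measurable ?M haar_SL2"
        using i by (intro measurable_compose[OF measurable_snd measurable_tuples_nth]) auto
      then have "(\<lambda>z. adj2 (fst z) ** snd z i) \<in> measurable ?M haar_SL2"
        by (intro measurable_mult_SL2 measurable_compose[OF measurable_fst measurable_adj2])
      then show "(\<lambda>z. r (adj2 (fst z) ** snd z i)) \<in> measurable ?M haar_torus"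
        by (rule measurable_compose[OF _ rm])
    qed
    fix h assume "h \<in> space haar_SL2"
    then have "nonsingular haar_SL2 haar_torus (\<lambda>g. r (adj2 h ** g))"
      by (intro nonsingular_compose[OF nonsingular_mult_left rns] adj2_SL2) simp
    from nonsingular_PiM_map[OF sf(4,6) finite_lessThan this, of 2]
    show "nonsingular ?H2 (tuples 2 haar_torus) (\<lambda>y. ?p (h, y))"
      by (simp add: numeral_2_eq_2)
  qed
  from nonsingular_AE[OF this torus_class_AE[OF f]]
  have f_eq: "AE z in ?M. f (?p z) = torus_cocycle \<alpha> (?p z)" .
  have "AE z in ?M. ?F z = f (?p z)"
  proof -
    have "AE z in ?M. F (snd z, \<lambda>j\<in>{..<1}. coset_pair (fst z)) =
        f (\<lambda>i\<in>{..<2}. r (diag_act (Suc 1) (**) (matrix_inv (fst z)) (snd z) i))"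
      using F unfolding eckmann_shapiro_def by blast
    then show ?thesis using AE_space
    proof eventually_elim
      case (elim z)
      have "(\<lambda>i\<in>{..<2}. r (diag_act (Suc 1) (**) (matrix_inv (fst z)) (snd z) i)) = ?p z"
        using spM[OF elim(2)] by (auto simp: fun_eq_iff diag_act_def matrix_inv_SL2)
      then show ?case using elim(1) by (simp only: tuple1_def)
    qed
  qed
  then have diff: "AE z in ?M. ?F z - ?G z = \<delta> (adj2 (fst z) ** snd z 1) - \<delta> (adj2 (fst z) ** snd z 0)"
    using f_eq AE_space
  proof eventually_elim
    case (elim z)
    note z = spM[OF elim(3)]
    have k: "adj2 (fst z) ** snd z 0 \<in> SL2" "adj2 (fst z) ** snd z 1 \<in> SL2"
      using z by (auto intro!: SL2_mult adj2_SL2)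
    have "torus_cocycle \<alpha> (?p z) = slope \<alpha> *
        (ln (r (adj2 (fst z) ** snd z 1) $1$1) - ln (r (adj2 (fst z) ** snd z 0) $1$1))"
      using torus_cocycle_eq[OF \<alpha>, of "?p z"] rT[OF k(1)] rT[OF k(2)] by simp
    then show ?case
      using elim(1,2) induced_cocycle_coset[of "fst z" "snd z" \<alpha>] z
      by (simp add: \<delta>_def algebra_simps)
  qed
  have average: "x = (c1 + d1) / 2 - (c0 + d0) / 2" if "x = d1 - d0" "x = c1 - c0" for x c0 c1 d0 d1 :: real
    using that by (simp add: field_simps)
  \<comment> \<open>Replacing h by -h does not change \<open>coset_pair h\<close>, hence not the
    left side of \<open>diff\<close>, while the arguments of \<open>\<delta>\<close> are negated.
    The mean of the two identities is the one for \<open>\<delta>'\<close>.\<close>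
  have "nonsingular ?M ?M (\<lambda>z. (fst z ** neg_one, snd z))"
    by (intro nonsingular_map_pair sf nonsingular_mult_right[OF neg] nonsingular_ident)
  from nonsingular_AE[OF this diff] diff AE_space
  have "AE z in ?M. F (snd z, tuple1 (coset_pair (fst z))) =
      induced_cocycle \<alpha> (snd z, tuple1 (coset_pair (fst z))) + d_up 0 b' (snd z, tuple1 (coset_pair (fst z)))"
  proof eventually_elim
    case (elim z)
    note z = spM[OF elim(3)]
    have c: "coset_pair (fst z ** neg_one) = coset_pair (fst z)"
      using z coset_pair_diag2[of "fst z" "- 1"] by simp
    have n: "adj2 (fst z ** neg_one) ** g = neg_one ** (adj2 (fst z) ** g)" for g :: "real^2^2"
      by (simp add: mat2_eq_iff matrix_mult_nth2)
    have "?F z - ?G z = \<delta>' (adj2 (fst z) ** snd z 1) - \<delta>' (adj2 (fst z) ** snd z 0)"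
      using elim(1,2) unfolding fst_conv snd_conv c n \<delta>'_def by (rule average)
    moreover have "b' (tuple1 (snd z i), tuple1 (coset_pair (fst z))) = \<delta>' (adj2 (fst z) ** snd z i)"
      if "i \<in> {0, 1}" for i
      using induce0_coset[OF \<delta>'_inv, of "fst z" "(tuple1 (snd z i), tuple1 (coset_pair (fst z)))"] z that
      unfolding b'_def by auto
    ultimately show ?case by (simp add: d_up_0)
  qed
  moreover have [measurable]: "F \<in> borel_measurable (bispace 1 1)" "induced_cocycle \<alpha> \<in> borel_measurable (bispace 1 1)"
    "d_up 0 b' \<in> borel_measurable (bispace 1 1)"
  proof -
    show "F \<in> borel_measurable (bispace 1 1)"
      using F unfolding eckmann_shapiro_def bicomplex_def L0_inv_def by blast
    show "induced_cocycle \<alpha> \<in> borel_measurable (bispace 1 1)"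
      using induced_cocycle_bicomplex unfolding bicomplex_def L0_inv_def by blast
    have b'm: "b' \<in> borel_measurable (bispace 0 1)"
      using b' unfolding bicomplex_def L0_inv_def by blast
    have "(\<lambda>z. b' (face 1 i (fst z), snd z)) \<in> borel_measurable (bispace 1 1)" for i
      using measurable_compose[OF nonsingular_measurable[OF nonsingular_bispace_face_fst[of 0 1 i]] b'm]
      by simp
    from this[of 0] this[of 1] show "d_up 0 b' \<in> borel_measurable (bispace 1 1)"
      unfolding face_1 d_up_0[abs_def] by (intro borel_measurable_diff)
  qed
  then have "{z\<in>space (bispace 1 1). F z = induced_cocycle \<alpha> z + d_up 0 b' z} \<in> sets (bispace 1 1)"
    by measurable
  ultimately have Fz: "AE z in bispace 1 1. F z = induced_cocycle \<alpha> z + d_up 0 b' z"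
    by (intro AE_bispace_from_coset)
  show ?thesis
  proof (rule that)
    show "(\<lambda>z. 1 * b z + 1 * b' z) \<in> bicomplex 0 1"
      using b(1) b' unfolding bicomplex_def by (rule L0_inv_lincomb)
    show "AE z in bispace 1 1. a z = induced_cocycle \<alpha> z + d_up 0 (\<lambda>z. 1 * b z + 1 * b' z) z"
      using b(2) Fz by eventually_elim (simp add: d_up_0)
  qed
qed

text \<open>The hypothesis says that almost any two group elements give the same function of the
  pairs. Fubini supplies one \<open>g0\<close> that agrees with almost every g, and evaluation at
  \<open>g0\<close> gives \<open>\<psi>\<close>. Diagonal invariance of \<open>\<gamma>\<close>
  becomes invariance of \<open>\<psi>\<close>, since translating the group variable no longer
  matters.\<close>

lemma d_up_zero_descends:
  assumes \<gamma>: "\<gamma> \<in> bicomplex 0 2" and zero: "AE z in bispace 1 2. d_up 0 \<gamma> z = 0"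
  obtains \<psi> where "\<psi> \<in> cochains SL2 mobius_pair pairs 1" "AE z in bispace 0 2. \<gamma> z = \<psi> (snd z)"
proof -
  note sf = sigma_finite_tuples sigma_finite_haar sigma_finite_pairs
  let ?Y = "tuples 2 pairs"
  have m: "\<gamma> \<in> borel_measurable (bispace 0 2)"
    and inv: "\<And>k. k \<in> SL2 \<Longrightarrow> AE z in bispace 0 2. \<gamma> (biact 0 2 k z) = \<gamma> z"
    using \<gamma> unfolding bicomplex_def L0_inv_def by blast+
  have ns1: "nonsingular (haar_SL2 \<Otimes>\<^sub>M ?Y) (bispace 0 2) (\<lambda>z. (tuple1 (fst z), snd z))"
    unfolding bispace_def One_nat_def[symmetric]
    by (intro nonsingular_map_pair nonsingular_tuple1 nonsingular_ident sf)
  have ns2: "nonsingular (bispace 0 2) (haar_SL2 \<Otimes>\<^sub>M ?Y) (\<lambda>z. (fst z 0, snd z))"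
    unfolding bispace_def
    by (intro nonsingular_map_pair nonsingular_component nonsingular_ident sf) auto
  have ns3: "nonsingular ((haar_SL2 \<Otimes>\<^sub>M haar_SL2) \<Otimes>\<^sub>M ?Y) (bispace 1 2)
      (\<lambda>z. (tuple2 (fst (fst z)) (snd (fst z)), snd z))"
    unfolding bispace_def Suc_1
    by (intro nonsingular_map_pair nonsingular_tuple2 nonsingular_ident sf sigma_finite_pair)
  define \<gamma>' where "\<gamma>' g y = \<gamma> (tuple1 g, y)" for g y
  have m': "(\<lambda>z. \<gamma>' (fst z) (snd z)) \<in> borel_measurable (haar_SL2 \<Otimes>\<^sub>M ?Y)"
    using measurable_compose[OF nonsingular_measurable[OF ns1] m] by (simp add: \<gamma>'_def)
  have "AE z in (haar_SL2 \<Otimes>\<^sub>M haar_SL2) \<Otimes>\<^sub>M ?Y. \<gamma>' (snd (fst z)) (snd z) = \<gamma>' (fst (fst z)) (snd z)"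
    using nonsingular_AE[OF ns3 zero] by (simp add: d_up_0 \<gamma>'_def)
  from AE_pairD[OF sigma_finite_pair[OF sf(4,4)] sf(2) this]
  have "AE x in haar_SL2 \<Otimes>\<^sub>M haar_SL2. AE y in ?Y. \<gamma>' (snd x) y = \<gamma>' (fst x) y"
    by simp
  from AE_pairD[OF sf(4,4) this]
  have "AE g0 in haar_SL2. AE g in haar_SL2. AE y in ?Y. \<gamma>' g y = \<gamma>' g0 y"
    by simp
  then obtain g0 where g0: "g0 \<in> SL2" "AE g in haar_SL2. AE y in ?Y. \<gamma>' g y = \<gamma>' g0 y"
    using AE_haar_ex by blast
  define \<psi> where "\<psi> = \<gamma>' g0"
  have \<psi>m: "\<psi> \<in> borel_measurable ?Y"
    unfolding \<psi>_def using measurable_compose[OF measurable_Pair1' m'[unfolded \<gamma>'_def], of g0] g0(1)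
    by (simp add: \<gamma>'_def[abs_def])
  have "AE z in haar_SL2 \<Otimes>\<^sub>M ?Y. \<gamma>' (fst z) (snd z) = \<psi> (snd z)"
  proof (rule AE_pairI[OF sf(4,2)])
    note [measurable] = m' \<psi>m
    show "{z \<in> space (haar_SL2 \<Otimes>\<^sub>M ?Y). \<gamma>' (fst z) (snd z) = \<psi> (snd z)} \<in> sets (haar_SL2 \<Otimes>\<^sub>M ?Y)"
      by measurable
    show "AE g in haar_SL2. AE y in ?Y. \<gamma>' (fst (g, y)) (snd (g, y)) = \<psi> (snd (g, y))"
      using g0(2) by (simp add: \<psi>_def)
  qed
  from nonsingular_AE[OF ns2 this] AE_space
  have \<psi>: "AE z in bispace 0 2. \<gamma> z = \<psi> (snd z)"
  proof eventually_elim
    case (elim z)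
    have "tuple1 (fst z 0) = fst z"
      using elim(2) unfolding space_bispace One_nat_def[symmetric] by (blast intro: tuple1_nth_space)
    then show ?case using elim(1) by (simp add: \<gamma>'_def)
  qed
  have "AE y in ?Y. \<psi> (diag_act 2 mobius_pair k y) = \<psi> y" if k: "k \<in> SL2" for k
  proof (rule AE_bispace_snd)
    show "AE z in bispace 0 2. \<psi> (diag_act 2 mobius_pair k (snd z)) = \<psi> (snd z)"
      using nonsingular_AE[OF nonsingular_biact[OF k] \<psi>] \<psi> inv[OF k]
      by eventually_elim (simp add: biact_def)
  qed
  then have "\<psi> \<in> cochains SL2 mobius_pair pairs 1"
    unfolding cochains_def L0_inv_def Suc_1 using \<psi>m by blast
  then show ?thesis using \<psi> that by blast
qed

lemma coboundaries_2: "coboundaries \<Gamma> act M 2 = {f \<in> cochains \<Gamma> act M 2.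
    \<exists>h\<in>cochains \<Gamma> act M 1. AE x in tuples 3 M. f x = hdiff 2 h x}"
proof -
  have eq: "Suc 2 = (3::nat)" by simp
  show ?thesis unfolding coboundaries_def eq by simp
qed

lemma connecting_unique:
  assumes \<alpha>: "\<alpha> \<in> lie_torus_dual"
    and f: "f \<in> cohom_class torus (**) haar_torus 1 (torus_cocycle \<alpha>)"
    and a: "represents a f"
    and \<beta>: "\<beta> \<in> bicomplex 0 2" "AE z in bispace 1 2. d_up 0 \<beta> z = d_right 1 1 a z"
    and \<omega>: "\<omega> \<in> cocycles SL2 mobius_pair pairs 2"
      "AE z in bispace 0 3. d_right 0 2 \<beta> z = \<omega> (snd z)"
  shows "(\<lambda>w. \<omega> w - cross_ratio_cocycle \<alpha> w) \<in> coboundaries SL2 mobius_pair pairs 2"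
proof -
  obtain e where e: "e \<in> bicomplex 0 1" "AE z in bispace 1 1. a z = induced_cocycle \<alpha> z + d_up 0 e z"
    using represents_unique[OF \<alpha> f a] .
  \<comment> \<open>The vertical differentials of \<open>\<beta>\<close> and
    \<open>primitive \<alpha>\<close> differ by the horizontal differential of
    \<open>d_up 0 e\<close>. Since \<open>d_up\<close> and \<open>d_right\<close> anticommute,
    adding \<open>d_right 0 1 e\<close> cancels this. The coefficients 1 and -1 are written out to
    match \<open>L0_inv_lincomb\<close>.\<close>
  define \<gamma> where "\<gamma> z = 1 * (1 * \<beta> z + (-1) * primitive \<alpha> z) + 1 * d_right 0 1 e z" for z
  have \<gamma>b: "\<gamma> \<in> bicomplex 0 2"
    unfolding \<gamma>_def[abs_def]
    using \<beta>(1) primitive_bicomplex d_right_01_bicomplex[OF e(1)] unfolding bicomplex_def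
    by (intro L0_inv_lincomb)
  have a': "AE z in bispace 1 2. a (fst z, face 1 i (snd z)) =
      induced_cocycle \<alpha> (fst z, face 1 i (snd z)) + d_up 0 e (fst z, face 1 i (snd z))" for i
    using nonsingular_AE[OF nonsingular_bispace_face[of 1 1 i, unfolded Suc_1] e(2)] .
  have "AE z in bispace 1 2. d_up 0 \<gamma> z = 0"
    using a'[of 0] a'[of 1] \<beta>(2) d_up_primitive[of \<alpha>]
  proof eventually_elim
    case (elim z)
    then show ?case
      unfolding face_1 d_up_0 d_right_11 d_right_01 \<gamma>_def by simp
  qed
  then obtain \<psi> where \<psi>: "\<psi> \<in> cochains SL2 mobius_pair pairs 1" "AE z in bispace 0 2. \<gamma> z = \<psi> (snd z)"
    using d_up_zero_descends[OF \<gamma>b] by blast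
  have eq: "Suc 2 = (3::nat)" by simp
  have \<gamma>': "AE z in bispace 0 3. \<gamma> (fst z, face 2 i (snd z)) = \<psi> (face 2 i (snd z))" for i
    using nonsingular_AE[OF nonsingular_bispace_face[of 0 2 i, unfolded eq] \<psi>(2)] unfolding fst_conv snd_conv .
  \<comment> \<open>The minus sign is that of \<open>d_right 0 2\<close>; the contribution of
    \<open>e\<close> is a twofold horizontal differential and vanishes. The summand with coefficient
    0 only fits the shape of \<open>L0_inv_lincomb\<close>.\<close>
  define \<psi>' where "\<psi>' y = (-1) * \<psi> y + 0 * \<psi> y" for y
  have "AE z in bispace 0 3. \<omega> (snd z) - cross_ratio_cocycle \<alpha> (snd z) = hdiff 2 \<psi>' (snd z)"
    using \<gamma>'[of 0] \<gamma>'[of 1] \<gamma>'[of 2] \<omega>(2) d_right_primitive[of \<alpha>]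
  proof eventually_elim
    case (elim z)
    then show ?case
      unfolding face_2 d_right_02 hdiff_2 \<gamma>_def d_right_01 \<psi>'_def by simp
  qed
  then have "AE w in tuples 3 pairs. \<omega> w - cross_ratio_cocycle \<alpha> w = hdiff 2 \<psi>' w"
    by (rule AE_bispace_snd)
  moreover have "\<psi>' \<in> cochains SL2 mobius_pair pairs 1"
    using \<psi>(1) unfolding \<psi>'_def[abs_def] cochains_def by (intro L0_inv_lincomb)
  moreover have "(\<lambda>w. 1 * \<omega> w + (-1) * cross_ratio_cocycle \<alpha> w) \<in> cochains SL2 mobius_pair pairs 2"
    using \<omega>(1) cross_ratio_cocycle_in_cocycles[of \<alpha>] unfolding cocycles_def cochains_def
    by (intro L0_inv_lincomb) auto
  ultimately show ?thesis
    unfolding coboundaries_2 mult_1 mult_minus1 add_uminus_conv_diff by blast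
qed

text \<open>Almost everywhere distinctness ensures that \<open>\<omega>\<close> does not rest on the
  default values of division and \<open>ln\<close>. The relation \<open>connecting\<close> is
  asserted beside the equation for \<open>i_map\<close> because \<open>THE\<close> by itself does
  not guarantee that a value exists.\<close>

theorem theorem6:
  fixes \<alpha> :: "real^2^2 \<Rightarrow> real"
    and \<omega> :: "(nat \<Rightarrow> P1 \<times> P1) \<Rightarrow> real"
  assumes "\<alpha> \<in> lie_torus_dual"
    and "\<omega> = (\<lambda>w. 1 / 2 * \<alpha> (lie_of_real (ln
                \<bar>cross_ratio (snd (w 0)) (fst (w 1)) (snd (w 1)) (fst (w 2)) - 1\<bar>)))"
  shows "(AE w in tuples 3 pairs. distinct [snd (w 0), fst (w 1), snd (w 1), fst (w 2)]) \<and>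
         \<omega> \<in> cocycles SL2 mobius_pair pairs 2 \<and>
         connecting (cohom_class torus (**) haar_torus 1 (torus_cocycle \<alpha>))
                    (cohom_class SL2 mobius_pair pairs 2 \<omega>) \<and>
         i_map (cohom_class torus (**) haar_torus 1 (torus_cocycle \<alpha>)) =
           cohom_class SL2 mobius_pair pairs 2 \<omega>"
proof -
  let ?c = "cohom_class torus (**) haar_torus 1 (torus_cocycle \<alpha>)"
  let ?D = "cohom_class SL2 mobius_pair pairs 2 \<omega>"
  have \<omega>: "\<omega> = cross_ratio_cocycle \<alpha>"
    unfolding assms(2) by (rule ext) (rule cross_ratio_cocycle_eq[OF assms(1)])
  have "AE w in tuples 3 pairs. distinct [snd (w 0), fst (w 1), snd (w 1), fst (w 2)]"
    using AE_generic
  proof eventually_elim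
    case (elim w)
    then have "snd (w i) \<noteq> fst (w j) \<and> (i \<noteq> j \<longrightarrow> fst (w i) \<noteq> fst (w j) \<and> snd (w i) \<noteq> snd (w j))"
      if "i < 3" "j < 3" for i j
      using that by (simp add: generic_def)
    from this[of 0 1] this[of 0 2] this[of 1 1] this[of 1 2] show ?case by auto
  qed
  moreover have coc: "\<omega> \<in> cocycles SL2 mobius_pair pairs 2"
    unfolding \<omega> by (rule cross_ratio_cocycle_in_cocycles)
  moreover have con: "connecting ?c ?D"
    unfolding connecting_def
    using cohom_class_in[OF torus_cocycle_in_cocycles[OF assms(1)]]
      cohom_class_self[OF torus_cocycle_in_cocycles[OF assms(1)]] represents_induced_cocycle[OF assms(1)]
      primitive_bicomplex[of \<alpha>] d_up_primitive[of \<alpha>] coc d_right_primitive[of \<alpha>, folded \<omega>]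
    by blast
  moreover have "i_map ?c = ?D"
    unfolding i_map_def
  proof (rule the_equality[where P = "connecting ?c", OF con])
    fix D assume "connecting ?c D"
    then obtain f a \<beta> \<omega>' where *: "f \<in> ?c" "represents a f" "\<beta> \<in> bicomplex 0 2"
      "AE z in bispace 1 2. d_up 0 \<beta> z = d_right 1 1 a z" "\<omega>' \<in> cocycles SL2 mobius_pair pairs 2"
      "AE z in bispace 0 3. d_right 0 2 \<beta> z = \<omega>' (snd z)" "D = cohom_class SL2 mobius_pair pairs 2 \<omega>'"
      unfolding connecting_def by blast
    show "D = ?D"
      unfolding *(7)
      by (rule cohom_class_eqI[OF coc *(5) connecting_unique[OF assms(1) *(1-6), folded \<omega>], symmetric])
  qed
  ultimately show ?thesis by blast
qed

end
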